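(* Let $u,v$ be independent, each uniformly distributed on $\mathcal B_n$. Then $\mathbb E[\mathrm{FS}(u,v)]=n+O(1)$ as $n\to\infty$.
   Context: $\mathcal B_n$ is the set of Boolean permutations in $S_n$: those that can be written as a product of simple transpositions $s_i=(i\ i{+}1)$ in which no $s_i$ appears more than once. Let $S_{\mathbb Z_+}$ be the group of permutations of the positive integers fixing all but finitely many points; $S_n\subset S_{\mathbb Z_+}$ by letting $w\in S_n$ fix every $j>n$. For $w\in S_{\mathbb Z_+}$ let $\mathrm{FS}(w)=\min\{n\ge1: w\in S_n\}$. For $j\ge1$ let $\chi_j(w)=1$ if there exists $k<j$ with $w(k)>w(j)$ and $\chi_j(w)=0$ otherwise, and $\Lambda_i(w)=\sum_{j\ge i}\chi_j(w)$. For $u,v\in S_{\mathbb Z_+}$, $\mathrm{FS}(u,v)$ is the smallest $m$ such that every $w$ with nonzero Schubert structure constant $c^w_{u,v}$ (where $\mathfrak S_u\mathfrak S_v=\sum_w c^w_{u,v}\mathfrak S_w$) lies in $S_m$. It is known (Hardt–Wallach) that $\mathrm{FS}(u,v)=\max_{1\le i\le 1+\max(\mathrm{FS}(u),\mathrm{FS}(v))}(\Lambda_i(u)+\Lambda_i(v)+i-1)$. *)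

theory Defs
  imports
    "HOL-Library.Poly_Mapping"
    "HOL-Library.Landau_Symbols"
    "HOL-Combinatorics.Permutations"
    "HOL-Probability.Probability_Mass_Function"
begin

(* Permutations of the positive integers are functions on nat that fix 0. *)

definition Sym :: "nat \<Rightarrow> (nat \<Rightarrow> nat) set" where
  "Sym n = {w. w permutes {1..n}}"

definition Sym_inf :: "(nat \<Rightarrow> nat) set" where
  "Sym_inf = {w. w permutes {1..} \<and> finite {j. w j \<noteq> j}}"

definition simple_transp :: "nat \<Rightarrow> nat \<Rightarrow> nat" where
  "simple_transp i = Transposition.transpose i (Suc i)"

definition boolean_perms :: "nat \<Rightarrow> (nat \<Rightarrow> nat) set" where
  "boolean_perms n =
     {w \<in> Sym n. \<exists>is. distinct is \<and> set is \<subseteq> {1..<n} \<and> w = foldr (\<circ>) (map simple_transp is) id}"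

(* Polynomials over the integers in x_0, x_1, x_2, ...: a polynomial maps exponent vectors
   to coefficients.  The variable x_0 does not occur in any Schubert polynomial. *)

type_synonym poly_Z = "(nat \<Rightarrow>\<^sub>0 nat) \<Rightarrow>\<^sub>0 int"

definition X :: "nat \<Rightarrow> poly_Z" where
  "X i = Poly_Mapping.single (Poly_Mapping.single i 1) 1"

(* Exchanges x_i and x_{i+1}. *)
definition swap_vars :: "nat \<Rightarrow> poly_Z \<Rightarrow> poly_Z" where
  "swap_vars i f = Poly_Mapping.map_key (Poly_Mapping.map_key (simple_transp i)) f"

(* The quotient (f - s_i f) / (x_i - x_{i+1}), which is again a polynomial. *)
definition divided_diff :: "nat \<Rightarrow> poly_Z \<Rightarrow> poly_Z" where
  "divided_diff i f = (THE g. g * (X i - X (Suc i)) = f - swap_vars i f)"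

definition longest_perm :: "nat \<Rightarrow> nat \<Rightarrow> nat" where
  "longest_perm n i = (if 1 \<le> i \<and> i \<le> n then n + 1 - i else i)"

(* Lascoux and Schuetzenberger: the polynomial of the longest element of S_n is
   x_1^{n-1} x_2^{n-2} ... x_{n-1}, and passing from w to w s_i at a descent i of w
   applies the i-th divided difference. *)
inductive is_schubert :: "(nat \<Rightarrow> nat) \<Rightarrow> poly_Z \<Rightarrow> bool" where
  longest: "is_schubert (longest_perm n) (\<Prod>i=1..n. X i ^ (n - i))"
| descent: "is_schubert w f \<Longrightarrow> 1 \<le> i \<Longrightarrow> w i > w (Suc i) \<Longrightarrow>
     is_schubert (w \<circ> simple_transp i) (divided_diff i f)"

(* Well defined: the result depends neither on n nor on the chain of descents. *)
definition schubert :: "(nat \<Rightarrow> nat) \<Rightarrow> poly_Z" where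
  "schubert w = (THE f. is_schubert w f)"

(* schubert_coeff u v w is c^w_{u,v}.  The coefficients exist and are unique because the
   Schubert polynomials form a basis of the integer polynomials in x_1, x_2, .... *)
definition schubert_coeff :: "(nat \<Rightarrow> nat) \<Rightarrow> (nat \<Rightarrow> nat) \<Rightarrow> (nat \<Rightarrow> nat) \<Rightarrow> int" where
  "schubert_coeff u v =
     (THE c. finite {w. c w \<noteq> 0} \<and> {w. c w \<noteq> 0} \<subseteq> Sym_inf \<and>
             schubert u * schubert v = (\<Sum>w\<in>{w. c w \<noteq> 0}. of_int (c w) * schubert w))"

definition FS :: "(nat \<Rightarrow> nat) \<Rightarrow> (nat \<Rightarrow> nat) \<Rightarrow> nat" where
  "FS u v = (LEAST m. 1 \<le> m \<and> (\<forall>w\<in>Sym_inf. schubert_coeff u v w \<noteq> 0 \<longrightarrow> w \<in> Sym m))"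

end

theory Submission
  imports Defs
begin

text \<open>By the formula of Fomin and Stanley, the Schubert polynomial of \<open>w \<in> S_n\<close> is a coefficient of a
  product of rows \<open>(1 + x_k u_{n-1}) \<dots> (1 + x_k u_k)\<close> in the nilCoxeter algebra.  Every letter taken from
  row \<open>i\<close> creates a position beyond \<open>i\<close> that is no left-to-right maximum, and the later rows do not
  decrease the number of these, so the degree in \<open>x_i\<close> is at most \<open>\<Lambda>_{i+1}(w)\<close>.  On the other hand, the Schubert polynomials
  of \<open>S_m\<close> span exactly the polynomials of degree at most \<open>m - i\<close> in \<open>x_i\<close> for all \<open>i\<close>.  Hence \<open>FS(u, v)\<close>
  is determined by the degrees of the product; this gives
  \<open>FS(u, v) \<le> n + \<Sum>i<n. max 0 (\<Lambda>_{i+1}(u) + \<Lambda>_{i+1}(v) - (n - i))\<close> and, as degrees in a single variable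
  add up, \<open>u \<in> S_{FS(u, v)}\<close>.

  In a random Boolean permutation the density of the positions that are no left-to-right maximum is
  less than one half: the mean of \<open>t ^ \<Lambda>_{i+1}\<close> over the Boolean permutations
  of \<open>S_n\<close> is at most a constant times \<open>r ^ (n - i)\<close> with \<open>r\<^sup>2 < t\<close>.  Independence of \<open>u\<close> and \<open>v\<close> then makes
  the expected excess a convergent geometric series.  For the lower bound, Boolean permutations in
  \<open>S_k\<close> make up a fraction of at most \<open>2 ^ (k - n)\<close>.\<close>

section \<open>Variable swaps and divided differences\<close>

lemma simple_transp_apply:
  "simple_transp i j = (if j = i then Suc i else if j = Suc i then i else j)"
  by (simp add: simple_transp_def transpose_def)

lemma simple_transp_involutory [simp]: "simple_transp i (simple_transp i j) = j"
  by (simp add: simple_transp_def)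

lemma simple_transp_comp_involutory [simp]:
  "simple_transp i \<circ> simple_transp i = id"
  "w \<circ> simple_transp i \<circ> simple_transp i = w"
  by (simp_all add: fun_eq_iff)

lemma inj_simple_transp [simp]: "inj (simple_transp i)"
  by (metis inj_def simple_transp_involutory)

text \<open>Integer polynomials form the free abelian group on the exponent vectors, so a property
  compatible with differences need only be checked on monomials with coefficient 1.\<close>

lemma frag_add_induct [case_names zero one diff]:
  fixes f :: "'a \<Rightarrow>\<^sub>0 int"
  assumes "P 0" "\<And>a. P (frag_of a)" "\<And>f g. P f \<Longrightarrow> P g \<Longrightarrow> P (f - g)"
  shows "P f"
  using assms by (intro frag_induction[of f UNIV P]) auto

definition swap_exps :: "nat \<Rightarrow> (nat \<Rightarrow>\<^sub>0 nat) \<Rightarrow> (nat \<Rightarrow>\<^sub>0 nat)" where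
  "swap_exps i = Poly_Mapping.map_key (simple_transp i)"

lemma lookup_swap_exps [simp]:
  "Poly_Mapping.lookup (swap_exps i a) j = Poly_Mapping.lookup a (simple_transp i j)"
  by (simp add: swap_exps_def map_key.rep_eq)

lemma swap_exps_involutory [simp]: "swap_exps i (swap_exps i a) = a"
  by (rule poly_mapping_eqI) simp

lemma swap_exps_add: "swap_exps i (a + b) = swap_exps i a + swap_exps i b"
  by (rule poly_mapping_eqI) (simp add: lookup_add)

lemma swap_exps_zero [simp]: "swap_exps i 0 = 0"
  by (rule poly_mapping_eqI) simp

lemma inj_swap_exps [simp]: "inj (swap_exps i)"
  by (metis inj_def swap_exps_involutory)

lemma lookup_swap_vars [simp]:
  "Poly_Mapping.lookup (swap_vars i f) a = Poly_Mapping.lookup f (swap_exps i a)"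
  by (simp add: swap_vars_def swap_exps_def[symmetric] map_key.rep_eq)

lemma swap_vars_simps [simp]:
  "swap_vars i 0 = 0"
  "swap_vars i 1 = 1"
  "swap_vars i (f + g) = swap_vars i f + swap_vars i g"
  "swap_vars i (f - g) = swap_vars i f - swap_vars i g"
  "swap_vars i (- f) = - swap_vars i f"
proof -
  have "(swap_exps i a = 0) = (a = 0)" for a
    by (metis swap_exps_involutory swap_exps_zero)
  then show "swap_vars i 1 = 1"
    by (intro poly_mapping_eqI) (simp add: lookup_one)
qed (auto intro!: poly_mapping_eqI simp: lookup_add lookup_minus)

lemma swap_vars_single [simp]:
  "swap_vars i (Poly_Mapping.single a c) = Poly_Mapping.single (swap_exps i a) c"
  by (rule poly_mapping_eqI) (auto simp: lookup_single when_def)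

lemma swap_vars_mult [simp]: "swap_vars i (f * g) = swap_vars i f * swap_vars i g"
proof (induction f rule: frag_add_induct)
  case (one a)
  show ?case
    by (induction g rule: frag_add_induct)
      (simp_all add: mult_single swap_exps_add right_diff_distrib)
qed (simp_all add: left_diff_distrib)

lemma swap_vars_X [simp]: "swap_vars i (X j) = X (simple_transp i j)"
proof -
  have "swap_exps i (Poly_Mapping.single j 1) = Poly_Mapping.single (simple_transp i j) 1"
    by (rule poly_mapping_eqI) (auto simp: lookup_single when_def)
  then show ?thesis by (simp add: X_def)
qed

lemma X_diff_neq_0 [simp]: "X i - X (Suc i) \<noteq> 0"
  by (simp add: X_def) (metis lookup_single_eq lookup_single_not_eq n_not_Suc_n one_neq_zero)

text \<open>The polynomial ring is a domain, so the quotient under the definite description is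
  unique.\<close>

lemma divided_diff_eqI:
  assumes "g * (X i - X (Suc i)) = f - swap_vars i f"
  shows "divided_diff i f = g"
  unfolding divided_diff_def
proof (rule the_equality)
  show "g' = g" if "g' * (X i - X (Suc i)) = f - swap_vars i f" for g'
    using that assms X_diff_neq_0 by (metis mult_right_cancel)
qed (fact assms)

section \<open>The nilCoxeter algebra and the Schubert polynomials\<close>

text \<open>Right multiplication by the generator \<open>u_i\<close> of the nilCoxeter algebra, where a function
  \<open>F\<close> on permutations stands for the element \<open>\<Sum>w. F w w\<close>.\<close>

definition nil_op :: "nat \<Rightarrow> ((nat \<Rightarrow> nat) \<Rightarrow> 'a) \<Rightarrow> (nat \<Rightarrow> nat) \<Rightarrow> 'a::comm_ring_1" where
  "nil_op i F w = (if w i > w (Suc i) then F (w \<circ> simple_transp i) else 0)"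

text \<open>Right multiplication by \<open>1 + x u_i\<close>.\<close>

definition factor_op :: "'a \<Rightarrow> nat \<Rightarrow> ((nat \<Rightarrow> nat) \<Rightarrow> 'a) \<Rightarrow> (nat \<Rightarrow> nat) \<Rightarrow> 'a::comm_ring_1" where
  "factor_op x i F w = F w + x * nil_op i F w"

text \<open>\<open>foldr\<close> applies the largest index first, so this is right multiplication by
  \<open>(1 + x u_{n-1}) ... (1 + x u_k)\<close>.\<close>

definition row_op :: "nat \<Rightarrow> nat \<Rightarrow> 'a \<Rightarrow> ((nat \<Rightarrow> nat) \<Rightarrow> 'a) \<Rightarrow> (nat \<Rightarrow> nat) \<Rightarrow> 'a::comm_ring_1" where
  "row_op k n x F = foldr (factor_op x) [k..<n] F"

section \<open>Relations of the nilCoxeter algebra\<close>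

lemma nil_op_add: "nil_op i (\<lambda>w. F w + G w) = (\<lambda>w. nil_op i F w + nil_op i G w)"
  and nil_op_diff: "nil_op i (\<lambda>w. F w - G w) = (\<lambda>w. nil_op i F w - nil_op i G w)"
  and nil_op_cmult: "nil_op i (\<lambda>w. c * F w) = (\<lambda>w. c * nil_op i F w)"
  and nil_op_zero: "nil_op i (\<lambda>w. 0) = (\<lambda>w. 0)"
  by (auto simp: nil_op_def)

lemma nil_op_square: "nil_op i (nil_op i F) = (\<lambda>w. 0)"
  by (auto simp: nil_op_def simple_transp_apply)

lemma nil_op_commute:
  assumes "Suc i < j"
  shows "nil_op i (nil_op j F) = nil_op j (nil_op i F)"
proof
  fix w :: "nat \<Rightarrow> nat"
  have "w \<circ> simple_transp i \<circ> simple_transp j = w \<circ> simple_transp j \<circ> simple_transp i"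
    using assms by (auto simp: fun_eq_iff simple_transp_apply)
  then show "nil_op i (nil_op j F) w = nil_op j (nil_op i F) w"
    using assms by (auto simp: nil_op_def simple_transp_apply)
qed

lemma nil_op_braid:
  "nil_op i (nil_op (Suc i) (nil_op i F)) = nil_op (Suc i) (nil_op i (nil_op (Suc i) F))"
proof
  fix w :: "nat \<Rightarrow> nat"
  have "w \<circ> simple_transp i \<circ> simple_transp (Suc i) \<circ> simple_transp i =
      w \<circ> simple_transp (Suc i) \<circ> simple_transp i \<circ> simple_transp (Suc i)"
    by (auto simp: fun_eq_iff simple_transp_apply)
  then show "nil_op i (nil_op (Suc i) (nil_op i F)) w =
      nil_op (Suc i) (nil_op i (nil_op (Suc i) F)) w"
    by (auto simp: nil_op_def simple_transp_apply)
qed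

lemma factor_op_eq: "factor_op x i F = (\<lambda>w. F w + x * nil_op i F w)"
  by (simp add: factor_op_def fun_eq_iff)

lemma nil_op_factor_op_same: "nil_op i (factor_op x i F) = nil_op i F"
  by (simp add: factor_op_eq nil_op_add nil_op_cmult nil_op_square)

text \<open>As \<open>u_i\<close> squares to zero, \<open>1 - x u_i\<close> is the inverse of
  \<open>1 + x u_i\<close>.\<close>

lemma factor_op_minus: "factor_op (- x) i (factor_op x i F) = F"
  by (simp add: factor_op_eq[of "- x"] nil_op_factor_op_same) (simp add: factor_op_eq)

lemma nil_op_factor_op_commute:
  assumes "Suc i < j"
  shows "nil_op i (factor_op x j F) = factor_op x j (nil_op i F)"
  by (simp add: factor_op_eq nil_op_add nil_op_cmult nil_op_commute[OF assms])

lemma factor_op_commute: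
  assumes "Suc i < j"
  shows "factor_op x i (factor_op y j F) = factor_op y j (factor_op x i F)"
  by (simp add: factor_op_eq nil_op_add nil_op_cmult nil_op_commute[OF assms] algebra_simps)

lemma factor_op_linear:
  "factor_op x i (\<lambda>w. F w - G w) = (\<lambda>w. factor_op x i F w - factor_op x i G w)"
  "factor_op x i (\<lambda>w. c * F w) = (\<lambda>w. c * factor_op x i F w)"
  by (simp_all add: factor_op_eq nil_op_diff nil_op_cmult algebra_simps)

text \<open>With \<open>h_i(x) = 1 + x u_i\<close> this is the Yang-Baxter equation
  \<open>h_{i+1}(x-y) h_i(x) h_{i+1}(y) = h_i(y) h_{i+1}(x) h_i(x-y)\<close>, rearranged so that the
  two sides differ by exchanging \<open>x\<close> and \<open>y\<close>.\<close>

lemma factor_op_yang_baxter: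
  "factor_op y i (factor_op y (Suc i) (factor_op x i (factor_op (- y) (Suc i) F))) =
   factor_op x i (factor_op x (Suc i) (factor_op y i (factor_op (- x) (Suc i) F)))"
  by (simp add: factor_op_eq nil_op_add nil_op_cmult nil_op_square nil_op_zero nil_op_braid
      del: mult_minus_left minus_mult_left) (simp add: algebra_simps)

section \<open>Rows and their commutation\<close>

lemma row_op_step: "k < n \<Longrightarrow> row_op k n x F = factor_op x k (row_op (Suc k) n x F)"
  by (simp add: row_op_def upt_conv_Cons)

lemma row_op_empty: "n \<le> k \<Longrightarrow> row_op k n x F = F"
  by (simp add: row_op_def)

lemma row_op_linear:
  "row_op k n x (\<lambda>w. F w - G w) = (\<lambda>w. row_op k n x F w - row_op k n x G w)"
  "row_op k n x (\<lambda>w. c * F w) = (\<lambda>w. c * row_op k n x F w)"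
proof -
  have "foldr (factor_op x) is (\<lambda>w. F w - G w) =
      (\<lambda>w. foldr (factor_op x) is F w - foldr (factor_op x) is G w)" for "is"
    by (induction "is") (simp_all add: factor_op_linear)
  moreover have "foldr (factor_op x) is (\<lambda>w. c * F w) = (\<lambda>w. c * foldr (factor_op x) is F w)" for "is"
    by (induction "is") (simp_all add: factor_op_linear)
  ultimately show "row_op k n x (\<lambda>w. F w - G w) = (\<lambda>w. row_op k n x F w - row_op k n x G w)"
    "row_op k n x (\<lambda>w. c * F w) = (\<lambda>w. c * row_op k n x F w)"
    by (simp_all add: row_op_def)
qed

lemma factor_op_row_op_commute:
  assumes "Suc i < k"
  shows "factor_op x i (row_op k n y F) = row_op k n y (factor_op x i F)"
proof -
  have "\<forall>j\<in>set is. Suc i < j \<Longrightarrow>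
      factor_op x i (foldr (factor_op y) is F) = foldr (factor_op y) is (factor_op x i F)" for "is"
    by (induction "is") (simp_all add: factor_op_commute[of i])
  then show ?thesis using assms by (simp add: row_op_def)
qed

lemma nil_op_row_op_commute:
  assumes "Suc i < k"
  shows "nil_op i (row_op k n y F) = row_op k n y (nil_op i F)"
proof -
  have "\<forall>j\<in>set is. Suc i < j \<Longrightarrow>
      nil_op i (foldr (factor_op y) is F) = foldr (factor_op y) is (nil_op i F)" for "is"
    by (induction "is") (simp_all add: nil_op_factor_op_commute)
  then show ?thesis using assms by (simp add: row_op_def)
qed

lemma row_op_Suc_conv:
  "k < n \<Longrightarrow> row_op (Suc k) n x F = factor_op (- x) k (row_op k n x F)"
  by (simp add: row_op_step factor_op_minus)

text \<open>Induction on the number of factors. Both products are rewritten as the product of the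
  two rows starting at \<open>k + 1\<close>, symmetric by the induction hypothesis, followed by four
  factors, symmetric by the Yang-Baxter equation.\<close>

lemma row_op_commute: "row_op k n x (row_op k n y F) = row_op k n y (row_op k n x F)"
proof (induction "n - k" arbitrary: k F)
  case 0
  then show ?case by (simp add: row_op_empty)
next
  case (Suc d)
  then have k: "k < n" and IH: "\<And>F. row_op (Suc k) n x (row_op (Suc k) n y F) =
      row_op (Suc k) n y (row_op (Suc k) n x F)" by simp_all
  show ?case
  proof (cases "Suc k < n")
    case True
    have *: "row_op k n y (row_op k n x F) =
      factor_op y k (factor_op y (Suc k) (factor_op x k (factor_op (- y) (Suc k)
        (row_op (Suc k) n y (row_op (Suc k) n x F)))))" for x y :: 'a and F
    proof -
      have "row_op k n y (row_op k n x F) = factor_op y k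
          (factor_op y (Suc k) (row_op (Suc (Suc k)) n y (factor_op x k (row_op (Suc k) n x F))))"
        using k True by (simp add: row_op_step)
      also have "row_op (Suc (Suc k)) n y (factor_op x k (row_op (Suc k) n x F)) =
         factor_op x k (row_op (Suc (Suc k)) n y (row_op (Suc k) n x F))"
        by (simp add: factor_op_row_op_commute)
      also have "row_op (Suc (Suc k)) n y (row_op (Suc k) n x F) =
         factor_op (- y) (Suc k) (row_op (Suc k) n y (row_op (Suc k) n x F))"
        using True by (simp add: row_op_Suc_conv)
      finally show ?thesis .
    qed
    show ?thesis
      unfolding * by (subst IH) (rule factor_op_yang_baxter)
  next
    case False
    then have *: "row_op k n x F = factor_op x k F" for x :: 'a and F
      using k by (simp add: row_op_step row_op_empty)
    show ?thesis
      unfolding * by (simp add: factor_op_eq nil_op_add nil_op_cmult nil_op_square algebra_simps)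
  qed
qed

lemma factor_op_swap_vars:
  "swap_vars i (factor_op x k F w) = factor_op (swap_vars i x) k (\<lambda>w. swap_vars i (F w)) w"
  by (simp add: factor_op_def nil_op_def)

lemma row_op_swap_vars:
  "swap_vars i (row_op k n x F w) = row_op k n (swap_vars i x) (\<lambda>w. swap_vars i (F w)) w"
proof -
  have "(\<lambda>w. swap_vars i (foldr (factor_op x) is F w)) =
      foldr (factor_op (swap_vars i x)) is (\<lambda>w. swap_vars i (F w))" for "is"
    by (induction "is") (simp_all add: factor_op_swap_vars)
  then show ?thesis
    unfolding row_op_def by metis
qed

definition rows_op :: "nat \<Rightarrow> nat list \<Rightarrow> ((nat \<Rightarrow> nat) \<Rightarrow> poly_Z) \<Rightarrow> (nat \<Rightarrow> nat) \<Rightarrow> poly_Z" where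
  "rows_op n ks F = fold (\<lambda>k. row_op k n (X k)) ks F"

lemma rows_op_simps [simp]:
  "rows_op n [] F = F"
  "rows_op n (k # ks) F = rows_op n ks (row_op k n (X k) F)"
  "rows_op n (ks @ ls) F = rows_op n ls (rows_op n ks F)"
  by (simp_all add: rows_op_def)

definition unit_fun :: "(nat \<Rightarrow> nat) \<Rightarrow> poly_Z" where
  "unit_fun w = (if w = id then 1 else 0)"

text \<open>The formula of Fomin and Stanley: the Schubert polynomial of \<open>w\<close> is the coefficient of
  \<open>w\<close> in the product of the rows \<open>(1 + x_k u_{n-1}) \<dots> (1 + x_k u_k)\<close>, \<open>k = 1, \<dots>, n - 1\<close>.\<close>

definition schub_fun :: "nat \<Rightarrow> (nat \<Rightarrow> nat) \<Rightarrow> poly_Z" where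
  "schub_fun n = rows_op n [1..<n] unit_fun"

lemma rows_op_swap_vars:
  assumes "i \<notin> set ks" "Suc i \<notin> set ks"
  shows "swap_vars i (rows_op n ks F w) = rows_op n ks (\<lambda>w. swap_vars i (F w)) w"
  using assms
proof (induction ks arbitrary: F)
  case (Cons k ks)
  then show ?case
    by (simp add: row_op_swap_vars simple_transp_apply)
qed simp

lemma rows_op_linear:
  "rows_op n ks (\<lambda>w. F w - G w) = (\<lambda>w. rows_op n ks F w - rows_op n ks G w)"
  "rows_op n ks (\<lambda>w. c * F w) = (\<lambda>w. c * rows_op n ks F w)"
  by (induction ks arbitrary: F G) (simp_all add: row_op_linear)

lemma nil_op_rows_op_commute:
  assumes "\<And>k. k \<in> set ks \<Longrightarrow> Suc i < k"
  shows "nil_op i (rows_op n ks F) = rows_op n ks (nil_op i F)"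
  using assms by (induction ks arbitrary: F) (simp_all add: nil_op_row_op_commute)

text \<open>Only rows \<open>i\<close> and \<open>i + 1\<close> involve the two variables. Together
  they are the symmetric product of two rows starting at \<open>i\<close>, times
  \<open>1 - y u_i\<close>. The swap turns this last factor into \<open>1 - x u_i\<close>, so the
  difference is \<open>(x - y) u_i\<close>, and \<open>u_i\<close> commutes with all later
  rows.\<close>

lemma schub_fun_diff:
  assumes i: "1 \<le> i" "i < n"
  shows "nil_op i (schub_fun n) w * (X i - X (Suc i)) = schub_fun n w - swap_vars i (schub_fun n w)"
proof -
  define x where "x = X i"
  define y where "y = X (Suc i)"
  define G where "G = rows_op n [1..<i] unit_fun"
  define Q where "Q = row_op i n y (row_op i n x G)"
  define R where "R = rows_op n [Suc (Suc i)..<n]"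
  have "(\<lambda>w. swap_vars i (unit_fun w)) = unit_fun"
    by (simp add: unit_fun_def fun_eq_iff)
  then have swap_G: "(\<lambda>w. swap_vars i (G w)) = G"
    by (simp add: G_def rows_op_swap_vars fun_eq_iff)
  have *: "schub_fun n = R (factor_op (- y) i Q)"
  proof (cases "Suc i < n")
    case True
    then have "[1..<n] = [1..<i] @ i # Suc i # [Suc (Suc i)..<n]"
      using i upt_add_eq_append[of 1 i "n - i"] by (simp add: upt_conv_Cons)
    then show ?thesis
      using i by (simp add: schub_fun_def R_def Q_def G_def row_op_Suc_conv x_def y_def)
  next
    case False
    then have "n = Suc i"
      using i by simp
    then have "[1..<n] = [1..<i] @ [i]"
      using i by simp
    \<comment> \<open>Here row \<open>i + 1\<close> is absent; the row in \<open>y\<close> starting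
      at \<open>i\<close> is the single factor \<open>1 + y u_i\<close>, which cancels against
      \<open>1 - y u_i\<close>.\<close>
    then show ?thesis
      using i False by (simp add: schub_fun_def R_def Q_def G_def row_op_step row_op_empty
        factor_op_minus x_def y_def)
  qed
  have swap: "(\<lambda>w. swap_vars i (schub_fun n w)) = R (factor_op (- x) i Q)"
  proof -
    have "(\<lambda>w. swap_vars i (schub_fun n w)) = R (\<lambda>w. swap_vars i (factor_op (- y) i Q w))"
      unfolding * R_def by (rule ext, rule rows_op_swap_vars) auto
    also have "(\<lambda>w. swap_vars i (factor_op (- y) i Q w)) =
        factor_op (- x) i (\<lambda>w. swap_vars i (Q w))"
      by (simp add: factor_op_swap_vars x_def y_def simple_transp_apply)
    also have "(\<lambda>w. swap_vars i (Q w)) = row_op i n x (row_op i n y G)"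
      by (simp add: Q_def row_op_swap_vars swap_G x_def y_def simple_transp_apply fun_eq_iff)
    also have "\<dots> = Q"
      unfolding Q_def by (rule row_op_commute)
    finally show ?thesis .
  qed
  have "(\<lambda>w. schub_fun n w - swap_vars i (schub_fun n w)) =
      R (\<lambda>w. factor_op (- y) i Q w - factor_op (- x) i Q w)"
    unfolding R_def rows_op_linear using * swap by (simp add: fun_eq_iff R_def)
  also have "(\<lambda>w. factor_op (- y) i Q w - factor_op (- x) i Q w) = (\<lambda>w. (x - y) * nil_op i Q w)"
    by (simp add: factor_op_def fun_eq_iff algebra_simps)
  \<comment> \<open>\<open>u_i\<close> absorbs the factor \<open>1 - y u_i\<close>, which brings
    back the actual rows of \<open>schub_fun n\<close>.\<close>
  also have "nil_op i Q = nil_op i (factor_op (- y) i Q)"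
    by (simp add: nil_op_factor_op_same)
  also have "R (\<lambda>w. (x - y) * nil_op i (factor_op (- y) i Q) w) =
      (\<lambda>w. (x - y) * nil_op i (schub_fun n) w)"
    unfolding * R_def by (subst nil_op_rows_op_commute) (simp_all add: rows_op_linear)
  finally show ?thesis
    by (simp add: fun_eq_iff x_def y_def mult.commute)
qed

lemma divided_diff_schub_fun:
  assumes "1 \<le> i" "i < n"
  shows "divided_diff i (schub_fun n w) =
    (if w i > w (Suc i) then schub_fun n (w \<circ> simple_transp i) else 0)"
  using divided_diff_eqI[OF schub_fun_diff[OF assms]] by (simp add: nil_op_def)

section \<open>Finite symmetric groups and stability in the rank\<close>

lemma simple_transp_in_Sym: "1 \<le> i \<Longrightarrow> i < n \<Longrightarrow> simple_transp i \<in> Sym n"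
  unfolding simple_transp_def Sym_def by (auto intro: permutes_swap_id)

lemma Sym_comp: "v \<in> Sym n \<Longrightarrow> w \<in> Sym n \<Longrightarrow> v \<circ> w \<in> Sym n"
  by (simp add: Sym_def permutes_compose)

lemma id_in_Sym: "id \<in> Sym n"
  by (simp add: Sym_def permutes_id)

lemma finite_Sym: "finite (Sym n)"
  by (simp add: Sym_def finite_permutations)

lemma Sym_mono: "m \<le> n \<Longrightarrow> w \<in> Sym m \<Longrightarrow> w \<in> Sym n"
  unfolding Sym_def by (auto intro: permutes_subset)

lemma Sym_fixes: "w \<in> Sym n \<Longrightarrow> n < j \<Longrightarrow> w j = j"
  and Sym_fixes_0: "w \<in> Sym n \<Longrightarrow> w 0 = 0"
  by (simp_all add: Sym_def permutes_not_in)

lemma Sym_in_range: "w \<in> Sym n \<Longrightarrow> w j \<in> {1..n} \<longleftrightarrow> j \<in> {1..n}"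
  by (simp only: Sym_def mem_Collect_eq permutes_in_image)

lemma Sym_le: "w \<in> Sym n \<Longrightarrow> j \<le> n \<Longrightarrow> w j \<le> n"
  using Sym_in_range[of w n j] Sym_fixes_0[of w n] by (cases "j = 0") simp_all

lemma Sym_ge: "w \<in> Sym n \<Longrightarrow> 1 \<le> j \<Longrightarrow> 1 \<le> w j"
  using Sym_in_range[of w n j] Sym_fixes[of w n j] by (cases "j \<le> n") simp_all

lemma Sym_inj: "w \<in> Sym n \<Longrightarrow> inj w"
  by (auto simp: Sym_def permutes_inj)

lemma Sym_comp_simple_transp: "w \<in> Sym n \<Longrightarrow> 1 \<le> i \<Longrightarrow> i < n \<Longrightarrow> w \<circ> simple_transp i \<in> Sym n"
  by (simp add: Sym_comp simple_transp_in_Sym)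

lemma Sym_descent_less: "w \<in> Sym n \<Longrightarrow> w i > w (Suc i) \<Longrightarrow> i < n"
  using Sym_fixes[of w n i] Sym_fixes[of w n "Suc i"] Sym_le[of w n i]
  by (cases "i < n"; cases "i = n") auto

lemma Sym_ascent: "w \<in> Sym n \<Longrightarrow> \<not> w i > w (Suc i) \<Longrightarrow> w i < w (Suc i)"
  using Sym_inj[of w n] by (auto simp: inj_eq not_less le_less)

lemma row_op_Sym_cong:
  assumes "1 \<le> k" "\<And>w. w \<in> Sym n \<Longrightarrow> F w = G w" "w \<in> Sym n"
  shows "row_op k n x F w = row_op k n x G w"
proof -
  have "\<forall>j\<in>set is. 1 \<le> j \<and> j < n \<Longrightarrow>
      \<forall>w\<in>Sym n. foldr (factor_op x) is F w = foldr (factor_op x) is G w" for "is"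
    using assms(2)
    by (induction "is") (auto simp: factor_op_def nil_op_def Sym_comp_simple_transp)
  then show ?thesis using assms by (simp add: row_op_def)
qed

lemma rows_op_Sym_cong:
  assumes "\<And>k. k \<in> set ks \<Longrightarrow> 1 \<le> k" "\<And>w. w \<in> Sym n \<Longrightarrow> F w = G w" "w \<in> Sym n"
  shows "rows_op n ks F w = rows_op n ks G w"
  using assms
proof (induction ks arbitrary: F G)
  case (Cons k ks)
  show ?case
    unfolding rows_op_simps
    by (rule Cons.IH) (use Cons.prems row_op_Sym_cong[of k n F G] in auto)
qed simp

lemma factor_op_top_Sym: "w \<in> Sym n \<Longrightarrow> factor_op x n F w = F w"
  using Sym_descent_less[of w n n] by (auto simp: factor_op_def nil_op_def)

lemma row_op_Suc_Sym:
  assumes "1 \<le> k" "k \<le> n" "w \<in> Sym n"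
  shows "row_op k (Suc n) x F w = row_op k n x F w"
proof -
  have "row_op k (Suc n) x F = row_op k n x (factor_op x n F)"
    using assms by (simp add: row_op_def)
  then show ?thesis
    using row_op_Sym_cong[of k n "factor_op x n F" F w x] assms by (simp add: factor_op_top_Sym)
qed

text \<open>A permutation in \<open>Sym n\<close> has no descent at \<open>n\<close>, so the new
  factor \<open>1 + x_k u_n\<close> of each row contributes nothing, and the new row
  \<open>n\<close> reduces to an empty one.\<close>

lemma schub_fun_Suc:
  assumes w: "w \<in> Sym n" and n: "1 \<le> n"
  shows "schub_fun (Suc n) w = schub_fun n w"
proof -
  have *: "rows_op (Suc n) ks F w = rows_op n ks F w"
    if "w \<in> Sym n" "\<And>k. k \<in> set ks \<Longrightarrow> 1 \<le> k \<and> k \<le> n" for ks F w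
    using that
  proof (induction ks arbitrary: F)
    case (Cons k ks)
    have "rows_op (Suc n) (k # ks) F w = rows_op n ks (row_op k (Suc n) (X k) F) w"
      using Cons by simp
    also have "\<dots> = rows_op n ks (row_op k n (X k) F) w"
      by (rule rows_op_Sym_cong) (use Cons.prems in \<open>auto simp: row_op_Suc_Sym\<close>)
    finally show ?case by simp
  qed simp
  have "schub_fun (Suc n) w = rows_op n [1..<Suc n] unit_fun w"
    unfolding schub_fun_def by (rule *) (use w in auto)
  also have "\<dots> = schub_fun n w"
    using n by (simp add: schub_fun_def row_op_empty)
  finally show ?thesis .
qed

lemma schub_fun_stable:
  assumes "w \<in> Sym n" "1 \<le> n" "n \<le> m"
  shows "schub_fun m w = schub_fun n w"
  using assms(3,1,2)
proof (induction m rule: dec_induct)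
  case (step m)
  then show ?case
    using schub_fun_Suc[of w m] Sym_mono[of n m w] by simp
qed simp

section \<open>Inversions and the coefficient of the longest permutation\<close>

definition invs :: "(nat \<Rightarrow> nat) \<Rightarrow> (nat \<times> nat) set" where
  "invs w = {(a, b). a < b \<and> w b < w a}"

lemma finite_invs: "w \<in> Sym n \<Longrightarrow> finite (invs w)"
proof (rule finite_subset)
  assume w: "w \<in> Sym n"
  show "invs w \<subseteq> {..n} \<times> {..n}"
  proof (clarsimp simp: invs_def)
    fix a b assume ab: "a < b" "w b < w a"
    have "b \<le> n"
    proof (rule ccontr)
      assume b: "\<not> b \<le> n"
      then have "w b = b" using w by (simp add: Sym_fixes)
      moreover have "w a \<le> max n a" using w by (cases "a \<le> n") (auto simp: Sym_le Sym_fixes le_max_iff_disj)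
      ultimately show False using ab b by simp
    qed
    then show "a \<le> n \<and> b \<le> n" using ab by simp
  qed
qed simp

text \<open>Applying \<open>s_i\<close> to both components maps the inversions of \<open>w\<close>
  other than \<open>(i, i + 1)\<close> bijectively onto those of \<open>w s_i\<close>.\<close>

lemma card_invs_comp_simple_transp:
  assumes "w \<in> Sym n" "w (Suc i) < w i"
  shows "card (invs w) = Suc (card (invs (w \<circ> simple_transp i)))"
proof -
  let ?s = "simple_transp i"
  have sub: "map_prod ?s ?s ` (invs v - {(i, Suc i)}) \<subseteq> invs (v \<circ> ?s)" for v
    by (auto simp: invs_def) (auto simp: simple_transp_apply)
  have "invs (w \<circ> ?s) \<subseteq> map_prod ?s ?s ` (invs w - {(i, Suc i)})"
  proof
    fix p assume p: "p \<in> invs (w \<circ> ?s)"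
    then have "p \<noteq> (i, Suc i)"
      using assms by (auto simp: invs_def simple_transp_apply)
    with p sub[of "w \<circ> ?s"] have "map_prod ?s ?s p \<in> invs w"
      by auto
    moreover have "map_prod ?s ?s p \<noteq> (i, Suc i)"
      using p by (auto simp: invs_def simple_transp_apply split: if_splits)
    moreover have "p = map_prod ?s ?s (map_prod ?s ?s p)"
      by (cases p) simp
    ultimately show "p \<in> map_prod ?s ?s ` (invs w - {(i, Suc i)})"
      by blast
  qed
  with sub[of w] have "invs (w \<circ> ?s) = map_prod ?s ?s ` (invs w - {(i, Suc i)})"
    by simp
  moreover have "inj_on (map_prod ?s ?s) A" for A
    by (rule inj_on_subset[OF _ subset_UNIV]) (simp add: prod.inj_map)
  ultimately have "card (invs (w \<circ> ?s)) = card (invs w - {(i, Suc i)})"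
    by (simp add: card_image)
  moreover have "(i, Suc i) \<in> invs w" using assms by (simp add: invs_def)
  ultimately show ?thesis
    using finite_invs[OF assms(1)] card_Suc_Diff1[of "invs w" "(i, Suc i)"] by simp
qed

text \<open>Each factor raises the length of a permutation in the support by at most one, so a letter is
  forced at every factor on the way to a permutation of maximal length in the support.\<close>

definition is_top :: "nat \<Rightarrow> ((nat \<Rightarrow> nat) \<Rightarrow> poly_Z) \<Rightarrow> (nat \<Rightarrow> nat) \<Rightarrow> poly_Z \<Rightarrow> bool" where
  "is_top n F w m \<longleftrightarrow> w \<in> Sym n \<and> F w = m \<and>
     (\<forall>v\<in>Sym n. card (invs w) < card (invs v) \<longrightarrow> F v = 0)"

lemma is_top_factor_op:
  assumes top: "is_top n F w m" and i: "1 \<le> i" "i < n" and asc: "w i < w (Suc i)"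
  shows "is_top n (factor_op x i F) (w \<circ> simple_transp i) (x * m)"
proof -
  let ?w = "w \<circ> simple_transp i"
  have w: "w \<in> Sym n" and F: "F w = m" and
    zero: "\<And>v. v \<in> Sym n \<Longrightarrow> card (invs w) < card (invs v) \<Longrightarrow> F v = 0"
    using top by (auto simp: is_top_def)
  have w': "?w \<in> Sym n" using w i by (simp add: Sym_comp_simple_transp)
  have desc: "?w (Suc i) < ?w i" using asc by (simp add: simple_transp_apply)
  have card: "card (invs ?w) = Suc (card (invs w))"
    using card_invs_comp_simple_transp[OF w' desc] by (simp only: simple_transp_comp_involutory)
  have "factor_op x i F ?w = x * m"
    using zero[OF w'] card desc F by (simp add: factor_op_def nil_op_def)
  moreover have "factor_op x i F v = 0" if v: "v \<in> Sym n" "card (invs ?w) < card (invs v)" for v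
  proof -
    have "F (v \<circ> simple_transp i) = 0" if "v (Suc i) < v i"
      using card_invs_comp_simple_transp[OF v(1) that] card v i
      by (intro zero) (simp_all add: Sym_comp_simple_transp)
    then show ?thesis
      using zero[OF v(1)] v card by (simp add: factor_op_def nil_op_def)
  qed
  ultimately show ?thesis
    using w' by (simp add: is_top_def)
qed

text \<open>The permutation obtained from the identity by multiplying with the first \<open>k\<close> full rows and
  with the first letters \<open>u_{n-1}, \<dots>, u_j\<close> of the next one.\<close>

definition partial_longest :: "nat \<Rightarrow> nat \<Rightarrow> nat \<Rightarrow> nat \<Rightarrow> nat" where
  "partial_longest n k j i = (if i = 0 \<or> n < i then i else if i \<le> k then n + 1 - i
     else if i < j then i - k else if i = j then n - k else i - 1 - k)"

lemma partial_longest_step: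
  assumes "k < j" "j < n"
  shows "partial_longest n k (Suc j) \<circ> simple_transp j = partial_longest n k j"
    and "partial_longest n k (Suc j) j < partial_longest n k (Suc j) (Suc j)"
  using assms by (auto simp: partial_longest_def fun_eq_iff simple_transp_apply)

lemma partial_longest_row:
  "k < n \<Longrightarrow> partial_longest n k (Suc k) = partial_longest n (Suc k) n"
  by (auto simp: partial_longest_def fun_eq_iff)

lemma is_top_row_op:
  assumes "is_top n F (partial_longest n k n) m" "k < n"
  shows "is_top n (row_op (Suc k) n x F) (partial_longest n (Suc k) n) (x ^ (n - Suc k) * m)"
proof -
  have "Suc k \<le> n" using assms by simp
  then have "is_top n (row_op (Suc k) n x F) (partial_longest n k (Suc k)) (x ^ (n - Suc k) * m)"
  proof (induction rule: inc_induct)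
    case base
    then show ?case using assms by (simp add: row_op_empty)
  next
    case (step j)
    have "is_top n (factor_op x j (row_op (Suc j) n x F))
        (partial_longest n k (Suc j) \<circ> simple_transp j) (x * (x ^ (n - Suc j) * m))"
      using step partial_longest_step[of k j n] by (intro is_top_factor_op) auto
    moreover have "n - j = Suc (n - Suc j)" using step by simp
    ultimately show ?case
      using step partial_longest_step[of k j n] by (simp add: row_op_step mult.assoc)
  qed
  then show ?thesis using assms by (simp add: partial_longest_row)
qed

lemma is_top_rows_op:
  assumes "k < n"
  shows "is_top n (rows_op n [1..<Suc k] unit_fun) (partial_longest n k n) (\<Prod>i=1..k. X i ^ (n - i))"
  using assms
proof (induction k)
  case 0
  have "partial_longest n 0 n = id" by (auto simp: partial_longest_def fun_eq_iff)
  moreover have "invs id = {}" by (auto simp: invs_def)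
  ultimately show ?case
    by (auto simp: is_top_def id_in_Sym unit_fun_def)
next
  case (Suc k)
  have rows: "rows_op n [1..<Suc (Suc k)] unit_fun =
      row_op (Suc k) n (X (Suc k)) (rows_op n [1..<Suc k] unit_fun)"
    by simp
  have prod: "(\<Prod>i=1..Suc k. X i ^ (n - i)) = X (Suc k) ^ (n - Suc k) * (\<Prod>i=1..k. X i ^ (n - i))"
    by (simp add: mult.commute)
  show ?case
    unfolding rows prod using Suc.prems by (intro is_top_row_op Suc.IH) linarith+
qed

lemma schub_fun_longest:
  assumes "1 \<le> n"
  shows "schub_fun n (longest_perm n) = (\<Prod>i=1..n. X i ^ (n - i))" "longest_perm n \<in> Sym n"
proof -
  obtain k where n: "n = Suc k" using assms by (cases n) auto
  \<comment> \<open>With \<open>k = n - 1\<close> full rows only position \<open>n\<close> lies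
    outside the reversed block, and its value \<open>n - k = 1\<close> is already that of the
    longest element.\<close>
  have "partial_longest n k n = longest_perm n"
    by (auto simp: fun_eq_iff n partial_longest_def longest_perm_def)
  then show "schub_fun n (longest_perm n) = (\<Prod>i=1..n. X i ^ (n - i))" "longest_perm n \<in> Sym n"
    using is_top_rows_op[of k n] by (simp_all add: n is_top_def schub_fun_def)
qed

text \<open>Whatever chain of descents is used, the result is the Fomin-Stanley coefficient; this is
  the uniqueness behind \<open>schubert\<close>. All large ranks are treated at once because a chain
  may start at a longest element of any rank.\<close>

lemma is_schubert_imp_schub_fun:
  assumes "is_schubert w f"
  shows "\<exists>m\<ge>1. \<forall>n\<ge>m. w \<in> Sym n \<and> f = schub_fun n w"
  using assms
proof induction
  case (longest n)
  show ?case
  proof (cases "n = 0")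
    case True
    \<comment> \<open>The start at rank 0 is the identity, which is treated in \<open>S_1\<close>
      because stability asks for a positive rank.\<close>
    have "schub_fun (Suc 0) id = 1" "longest_perm 0 = id"
      by (auto simp: schub_fun_def unit_fun_def longest_perm_def)
    then have "longest_perm n \<in> Sym m \<and> (\<Prod>i=1..n. X i ^ (n - i)) = schub_fun m (longest_perm n)"
      if "m \<ge> 1" for m
      using True that schub_fun_stable[of id 1 m] by (simp add: id_in_Sym)
    then show ?thesis by (intro exI[of _ 1] conjI allI impI order_refl) simp_all
  next
    case False
    then have "longest_perm n \<in> Sym m \<and> (\<Prod>i=1..n. X i ^ (n - i)) = schub_fun m (longest_perm n)"
      if "m \<ge> n" for m
      using that schub_fun_longest[of n] schub_fun_stable[of "longest_perm n" n m]
        Sym_mono[of n m "longest_perm n"] by simp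
    with False show ?thesis by (intro exI[of _ n] conjI allI impI) simp_all
  qed
next
  case (descent w f i)
  then obtain m where m: "m \<ge> 1" "\<And>n. n \<ge> m \<Longrightarrow> w \<in> Sym n \<and> f = schub_fun n w" by blast
  have "w \<circ> simple_transp i \<in> Sym n \<and> divided_diff i f = schub_fun n (w \<circ> simple_transp i)"
    if "n \<ge> m" for n
    using m(2)[OF that] descent Sym_descent_less[of w n i]
    by (simp add: Sym_comp_simple_transp divided_diff_schub_fun)
  with m(1) show ?case by (intro exI[of _ m]) fast
qed

lemma Sym_no_ascent:
  assumes w: "w \<in> Sym n" and dec: "\<And>i. 1 \<le> i \<Longrightarrow> i < n \<Longrightarrow> w (Suc i) < w i"
  shows "w = longest_perm n"
proof -
  have upper: "1 \<le> i \<Longrightarrow> i \<le> n \<Longrightarrow> w i + i \<le> n + 1" for i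
  proof (induction i rule: dec_induct)
    case base
    then show ?case using Sym_le[OF w, of 1] by simp
  next
    case (step i)
    then show ?case using dec[of i] by simp
  qed
  have lower: "n + 1 \<le> w i + i" if "1 \<le> i" "i \<le> n" for i
    using that(2,1)
  proof (induction i rule: inc_induct)
    case base
    then show ?case using Sym_ge[OF w, of n] by simp
  next
    case (step i)
    then show ?case using dec[of i] by simp
  qed
  show ?thesis
  proof
    fix i
    show "w i = longest_perm n i"
      using upper[of i] lower[of i] Sym_fixes[OF w, of i] Sym_fixes_0[OF w]
      by (cases "i = 0"; cases "i \<le> n") (auto simp: longest_perm_def)
  qed
qed

lemma Sym_no_descent:
  assumes w: "w \<in> Sym n" and inc: "\<And>i. 1 \<le> i \<Longrightarrow> i < n \<Longrightarrow> w i < w (Suc i)"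
  shows "w = id"
proof -
  have upper: "i \<le> w i" if "1 \<le> i" "i \<le> n" for i
    using that
  proof (induction i rule: dec_induct)
    case base
    then show ?case using Sym_ge[OF w, of 1] by simp
  next
    case (step i)
    then show ?case using inc[of i] by simp
  qed
  have lower: "w i \<le> i" if "1 \<le> i" "i \<le> n" for i
    using that(2,1)
  proof (induction i rule: inc_induct)
    case base
    then show ?case using Sym_le[OF w, of n] by simp
  next
    case (step i)
    then show ?case using inc[of i] by simp
  qed
  show ?thesis
  proof
    fix i
    show "w i = id i"
      using upper[of i] lower[of i] Sym_fixes[OF w, of i] Sym_fixes_0[OF w]
      by (cases "i = 0"; cases "i \<le> n") auto
  qed
qed

text \<open>Induction on the distance to the maximal length: unless \<open>w\<close> is longest it
  has an ascent \<open>i\<close>, and \<open>w\<close> is reached from the longer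
  \<open>w s_i\<close> by one descent.\<close>

lemma is_schubert_exists:
  assumes "w \<in> Sym n"
  shows "\<exists>f. is_schubert w f"
proof -
  define M where "M = Max ((\<lambda>v. card (invs v)) ` Sym n)"
  have M: "card (invs v) \<le> M" if "v \<in> Sym n" for v
    unfolding M_def using that by (intro Max_ge) (auto simp: finite_Sym)
  show ?thesis
    using assms
  proof (induction "M - card (invs w)" arbitrary: w rule: less_induct)
    case less
    show ?case
    proof (cases "\<forall>i. 1 \<le> i \<longrightarrow> i < n \<longrightarrow> w (Suc i) < w i")
      case True
      then have "w = longest_perm n" using less.prems by (intro Sym_no_ascent) auto
      then show ?thesis using is_schubert.longest by blast
    next
      case False
      then obtain i where i: "1 \<le> i" "i < n" "w i < w (Suc i)"
        using Sym_ascent[OF less.prems] by blast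
      let ?w = "w \<circ> simple_transp i"
      have w': "?w \<in> Sym n" using less.prems i by (simp add: Sym_comp_simple_transp)
      have desc: "?w (Suc i) < ?w i" using i by (simp add: simple_transp_apply)
      have "card (invs ?w) = Suc (card (invs w))"
        using card_invs_comp_simple_transp[OF w' desc] by (simp only: simple_transp_comp_involutory)
      then have "M - card (invs ?w) < M - card (invs w)"
        using M[OF w'] by simp
      from less.hyps[OF this w'] obtain f where "is_schubert ?w f" by blast
      from is_schubert.descent[OF this i(1) desc] show ?thesis
        unfolding simple_transp_comp_involutory by blast
    qed
  qed
qed

lemma schubert_eq_schub_fun:
  assumes "w \<in> Sym n" "1 \<le> n"
  shows "schubert w = schub_fun n w"
proof -
  have *: "f = schub_fun n w" if "is_schubert w f" for f
  proof -
    from is_schubert_imp_schub_fun[OF that] obtain m where "\<forall>k\<ge>m. f = schub_fun k w" by blast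
    then have "f = schub_fun (max m n) w" by simp
    then show ?thesis using schub_fun_stable[of w n "max m n"] assms by simp
  qed
  show ?thesis
    unfolding schubert_def using is_schubert_exists[OF assms(1)] * by (metis the_equality)
qed

section \<open>Degrees of Schubert polynomials in a single variable\<close>

text \<open>For \<open>w \<in> S_n\<close> this is the number \<open>\<Lambda>_{i+1}(w)\<close>; the index is shifted because it bounds the degree in
  \<open>x_i\<close>.\<close>

definition nonrec_count :: "nat \<Rightarrow> nat \<Rightarrow> (nat \<Rightarrow> nat) \<Rightarrow> nat" where
  "nonrec_count i n w = card {j \<in> {i<..n}. \<exists>k<j. w j < w k}"

lemma nonrec_count_le: "nonrec_count i n w \<le> n - i"
proof -
  have "nonrec_count i n w \<le> card {i<..n}"
    unfolding nonrec_count_def by (rule card_mono) auto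
  then show ?thesis by simp
qed

lemma nonrec_count_Suc_le: "nonrec_count (Suc i) n w \<le> nonrec_count i n w"
  unfolding nonrec_count_def by (rule card_mono) auto

lemma nonrec_simple_transp:
  assumes "l \<noteq> j" "l \<noteq> Suc j"
  shows "(\<exists>k<l. (w \<circ> simple_transp j) l < (w \<circ> simple_transp j) k) \<longleftrightarrow> (\<exists>k<l. w l < w k)"
proof -
  have "simple_transp j k < l" if "k < l" for k
    using that assms by (auto simp: simple_transp_apply)
  moreover have "simple_transp j l = l" using assms by (simp add: simple_transp_apply)
  ultimately show ?thesis
    by (metis comp_apply simple_transp_involutory)
qed

text \<open>The descent makes \<open>j + 1\<close> a position that is no left-to-right maximum of
  \<open>w\<close>, while later positions keep their status because the exchange only permutes
  positions before them.\<close>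

lemma nonrec_count_descent:
  assumes "w (Suc j) < w j" "j < n"
  shows "Suc (nonrec_count (Suc j) n (w \<circ> simple_transp j)) \<le> nonrec_count j n w"
proof -
  let ?A = "\<lambda>i w. {l \<in> {i<..n}. \<exists>k<l. w l < w k}"
  have eq: "?A (Suc j) (w \<circ> simple_transp j) = ?A (Suc j) w"
  proof (rule Collect_cong, rule conj_cong[OF refl])
    fix l assume "l \<in> {Suc j<..n}"
    then show "(\<exists>k<l. (w \<circ> simple_transp j) l < (w \<circ> simple_transp j) k) \<longleftrightarrow> (\<exists>k<l. w l < w k)"
      by (intro nonrec_simple_transp) auto
  qed
  have "insert (Suc j) (?A (Suc j) w) \<subseteq> ?A j w"
    using assms by auto
  then have "card (insert (Suc j) (?A (Suc j) w)) \<le> card (?A j w)"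
    by (rule card_mono[rotated]) simp
  then show ?thesis unfolding nonrec_count_def eq by simp
qed

text \<open>\<open>s_j\<close> injects the counted positions of \<open>w s_j\<close> into those of
  \<open>w\<close>: position \<open>j\<close> goes to \<open>j + 1\<close>, which counts because of
  the descent, and a witness for \<open>j + 1\<close> in \<open>w s_j\<close> is a witness for
  \<open>j\<close> in \<open>w\<close>.\<close>

lemma nonrec_count_simple_transp_le:
  assumes "w (Suc j) < w j" "i < j" "j < n"
  shows "nonrec_count i n (w \<circ> simple_transp j) \<le> nonrec_count i n w"
proof -
  let ?s = "simple_transp j"
  let ?A = "\<lambda>w. {l \<in> {i<..n}. \<exists>k<l. w l < w k}"
  have "?s l \<in> ?A w" if l: "l \<in> ?A (w \<circ> ?s)" for l
  proof -
    consider "l = j" | "l = Suc j" | "l \<noteq> j" "l \<noteq> Suc j" by blast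
    then show ?thesis
    proof cases
      case 1
      then show ?thesis using assms by (auto simp: simple_transp_apply)
    next
      case 2
      with l obtain k where "k < Suc j" "(w \<circ> ?s) (Suc j) < (w \<circ> ?s) k"
        by blast
      then have k: "k < Suc j" "w j < w (?s k)"
        by (simp_all add: simple_transp_apply[of j "Suc j"])
      then have "k < j" using assms by (cases "k = j") (auto simp: simple_transp_apply)
      with k show ?thesis using 2 assms by (auto simp: simple_transp_apply)
    next
      case 3
      with l nonrec_simple_transp[OF 3, of w] show ?thesis by (simp add: simple_transp_apply)
    qed
  qed
  then have "?s ` ?A (w \<circ> ?s) \<subseteq> ?A w" by blast
  moreover have "inj_on ?s (?A (w \<circ> ?s))"
    by (rule inj_on_subset[OF inj_simple_transp subset_UNIV])
  ultimately show ?thesis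
    unfolding nonrec_count_def by (intro card_inj_on_le) auto
qed

section \<open>Degree bounds for rows and their products\<close>

definition deg_le :: "nat \<Rightarrow> nat \<Rightarrow> poly_Z \<Rightarrow> bool" where
  "deg_le i d f \<longleftrightarrow> (\<forall>a\<in>Poly_Mapping.keys f. Poly_Mapping.lookup a i \<le> d)"

lemma deg_le_mono: "deg_le i d f \<Longrightarrow> d \<le> e \<Longrightarrow> deg_le i e f"
  by (auto simp: deg_le_def)

lemma deg_le_0 [simp]: "deg_le i d 0"
  by (simp add: deg_le_def)

lemma deg_le_add: "deg_le i d f \<Longrightarrow> deg_le i d g \<Longrightarrow> deg_le i d (f + g)"
  using keys_add[of f g] by (auto simp: deg_le_def)

lemma deg_le_mult: "deg_le i d f \<Longrightarrow> deg_le i e g \<Longrightarrow> deg_le i (d + e) (f * g)"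
  using keys_mult[of f g] by (force simp: deg_le_def lookup_add intro: add_mono)

lemma deg_le_X: "deg_le i (if k = i then 1 else 0) (X k)"
  by (auto simp: deg_le_def X_def lookup_single)

lemma deg_le_row_op_other:
  assumes "k \<noteq> i" "\<And>w. deg_le i d (F w)"
  shows "deg_le i d (row_op j n (X k) F w)"
proof -
  have "deg_le i d (foldr (factor_op (X k)) is F w)" for "is" w
  proof (induction "is" arbitrary: w)
    case (Cons j js)
    then show ?case
      using deg_le_mult[OF deg_le_X[of i k] Cons] assms
      by (auto simp: factor_op_def nil_op_def intro!: deg_le_add)
  qed (simp add: assms)
  then show ?thesis by (simp add: row_op_def)
qed

text \<open>The start of the row runs from \<open>n\<close> down to \<open>i\<close>, with the count
  beyond that start as the bound: taking the letter \<open>u_j\<close> costs one factor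
  \<open>x_i\<close> and adds at least one counted position.\<close>

lemma deg_le_row_op_same:
  assumes "i \<le> n" "\<And>w. deg_le i 0 (F w)"
  shows "deg_le i (nonrec_count i n w) (row_op i n (X i) F w)"
proof -
  have "deg_le i (nonrec_count j n w) (row_op j n (X i) F w)" if "j \<le> n" for j w
    using that
  proof (induction arbitrary: w rule: inc_induct)
    case base
    then show ?case using assms deg_le_mono[of i 0 "F w"] by (simp add: row_op_empty)
  next
    case (step j)
    let ?G = "row_op (Suc j) n (X i) F"
    have "deg_le i (nonrec_count j n w) (?G w)"
      using step.IH nonrec_count_Suc_le by (rule deg_le_mono)
    moreover have "deg_le i (nonrec_count j n w) (X i * ?G (w \<circ> simple_transp j))" if "w (Suc j) < w j"
    proof (rule deg_le_mono)
      show "deg_le i ((if i = i then 1 else 0) + nonrec_count (Suc j) n (w \<circ> simple_transp j))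
          (X i * ?G (w \<circ> simple_transp j))"
        by (rule deg_le_mult[OF deg_le_X step.IH])
      show "(if i = i then 1 else 0) + nonrec_count (Suc j) n (w \<circ> simple_transp j) \<le> nonrec_count j n w"
        using nonrec_count_descent[OF that step.hyps(2)] by (simp only: if_True plus_1_eq_Suc refl)
    qed
    ultimately show ?case
      using step.hyps by (simp add: row_op_step factor_op_def nil_op_def deg_le_add)
  qed
  then show ?thesis using assms by simp
qed

text \<open>The new letters carry no \<open>x_i\<close>, and passing from \<open>w s_j\<close> up to
  \<open>w\<close> does not decrease the count.\<close>

lemma deg_le_row_op_higher:
  assumes "i < k" "\<And>w. deg_le i (nonrec_count i n w) (F w)"
  shows "deg_le i (nonrec_count i n w) (row_op k n (X k) F w)"
proof -
  have "\<forall>j\<in>set is. i < j \<and> j < n \<Longrightarrow> deg_le i (nonrec_count i n w) (foldr (factor_op (X k)) is F w)"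
    for "is" w
  proof (induction "is" arbitrary: w)
    case (Cons j js)
    let ?G = "foldr (factor_op (X k)) js F"
    have IH: "deg_le i (nonrec_count i n w) (?G w)" for w using Cons by simp
    have "deg_le i (nonrec_count i n w) (X k * ?G (w \<circ> simple_transp j))" if "w (Suc j) < w j"
      using deg_le_mult[OF deg_le_X[of i k] IH[of "w \<circ> simple_transp j"]]
        nonrec_count_simple_transp_le[OF that, of i n] Cons.prems assms(1) by (auto intro: deg_le_mono)
    then show ?case
      using IH by (simp add: factor_op_def[of _ _ ?G] nil_op_def[of _ ?G] deg_le_add)
  qed (simp add: assms)
  then show ?thesis using assms(1) by (simp add: row_op_def)
qed

lemma deg_le_rows_op_other:
  assumes "i \<notin> set ks" "\<And>w. deg_le i d (F w)"
  shows "deg_le i d (rows_op n ks F w)"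
  using assms by (induction ks arbitrary: F) (simp_all add: deg_le_row_op_other)

lemma deg_le_unit_fun: "deg_le i 0 (unit_fun w)"
  by (simp add: unit_fun_def deg_le_def)

lemma deg_le_schub_fun:
  assumes "1 \<le> i"
  shows "deg_le i (nonrec_count i n w) (schub_fun n w)"
proof (cases "i < n")
  case True
  define F where "F = rows_op n [1..<i] unit_fun"
  have F: "deg_le i 0 (F w)" for w
    unfolding F_def by (rule deg_le_rows_op_other) (auto simp: deg_le_unit_fun)
  have "deg_le i (nonrec_count i n w) (rows_op n ks G w)"
    if "\<And>k. k \<in> set ks \<Longrightarrow> i < k" "\<And>w. deg_le i (nonrec_count i n w) (G w)" for ks G w
    using that by (induction ks arbitrary: G) (simp_all add: deg_le_row_op_higher)
  from this[of "[Suc i..<n]" "row_op i n (X i) F" w]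
  have "deg_le i (nonrec_count i n w) (rows_op n [Suc i..<n] (row_op i n (X i) F) w)"
    using True F by (simp add: deg_le_row_op_same)
  moreover have "[1..<n] = [1..<i] @ i # [Suc i..<n]"
    using True assms upt_add_eq_append[of 1 i "n - i"] by (simp add: upt_conv_Cons)
  ultimately show ?thesis by (simp add: schub_fun_def F_def)
next
  case False
  then have "deg_le i 0 (schub_fun n w)"
    unfolding schub_fun_def by (intro deg_le_rows_op_other) (auto simp: deg_le_unit_fun)
  then show ?thesis by (rule deg_le_mono) simp
qed

lemma deg_le_schub_fun_0: "deg_le 0 0 (schub_fun n w)"
  unfolding schub_fun_def by (intro deg_le_rows_op_other) (auto simp: deg_le_unit_fun)

section \<open>Existence of divided differences and dual functionals\<close>

lemma exps_induct [case_names zero step]: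
  fixes a :: "nat \<Rightarrow>\<^sub>0 nat"
  assumes "P 0" "\<And>a j. P a \<Longrightarrow> P (Poly_Mapping.single j 1 + a)"
  shows "P a"
proof (induction a rule: update_induct)
  case const
  show ?case by (rule assms)
next
  case (update a k v)
  have upd: "Poly_Mapping.update k v a = Poly_Mapping.single k v + a"
    using update by (intro poly_mapping_eqI)
      (auto simp: lookup_update lookup_add lookup_single when_def in_keys_iff)
  have "P (Poly_Mapping.single k v + a)" for v
  proof (induction v)
    case (Suc v)
    have "Poly_Mapping.single k (Suc v) + a = Poly_Mapping.single k 1 + (Poly_Mapping.single k v + a)"
      by (simp flip: add.assoc single_add)
    then show ?case using assms(2)[OF Suc] by simp
  qed (use update in simp)
  then show ?case by (simp add: upd)
qed

text \<open>Divisibility of \<open>f - s_i f\<close> by \<open>x_i - x_{i+1}\<close> is additive in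
  \<open>f\<close>, and for monomials it is propagated one variable at a time by a Leibniz
  rule.\<close>

lemma divided_diff_mult:
  "divided_diff i f * (X i - X (Suc i)) = f - swap_vars i f"
proof -
  have "(X i - X (Suc i)) dvd (f - swap_vars i f)"
  proof (induction f rule: frag_add_induct)
    case (one a)
    show ?case
    proof (induction a rule: exps_induct)
      case zero
      then show ?case by simp
    next
      case (step a j)
      let ?m = "frag_of a"
      have "frag_of (Poly_Mapping.single j 1 + a) = X j * ?m"
        by (simp add: X_def mult_single)
      then have "frag_of (Poly_Mapping.single j 1 + a) - swap_vars i (frag_of (Poly_Mapping.single j 1 + a)) =
          X j * (?m - swap_vars i ?m) + (X j - X (simple_transp i j)) * swap_vars i ?m"
        by (simp add: algebra_simps)
      moreover have "(X i - X (Suc i)) dvd (X j - X (simple_transp i j))"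
        using dvd_minus_iff[of "X i - X (Suc i)" "X i - X (Suc i)"] by (auto simp: simple_transp_apply)
      ultimately show ?case
        using step by (metis dvd_add dvd_mult dvd_mult2)
    qed
  next
    case (diff f g)
    have "f - g - swap_vars i (f - g) = (f - swap_vars i f) - (g - swap_vars i g)" by simp
    then show ?case using diff by (metis dvd_diff)
  qed simp
  then obtain g where "f - swap_vars i f = (X i - X (Suc i)) * g" ..
  then have "g * (X i - X (Suc i)) = f - swap_vars i f" by (simp add: mult.commute)
  with divided_diff_eqI[OF this] show ?thesis by simp
qed

lemma of_int_eq_single: "(of_int c :: poly_Z) = Poly_Mapping.single 0 c"
  using single_of_int[of c, where ?'a = "nat \<Rightarrow>\<^sub>0 nat" and ?'b = int] by (simp del: single_of_int)

lemma swap_vars_of_int [simp]: "swap_vars i (of_int c) = of_int c"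
  by (simp add: of_int_eq_single)

lemma divided_diff_linear:
  "divided_diff i (f + g) = divided_diff i f + divided_diff i g"
  "divided_diff i (of_int c * f) = of_int c * divided_diff i f"
proof -
  show "divided_diff i (f + g) = divided_diff i f + divided_diff i g"
    by (rule divided_diff_eqI) (simp only: distrib_right divided_diff_mult swap_vars_simps, simp)
  show "divided_diff i (of_int c * f) = of_int c * divided_diff i f"
  proof (rule divided_diff_eqI)
    have "of_int c * divided_diff i f * (X i - X (Suc i)) = of_int c * (f - swap_vars i f)"
      by (simp only: mult.assoc divided_diff_mult)
    then show "of_int c * divided_diff i f * (X i - X (Suc i)) = of_int c * f - swap_vars i (of_int c * f)"
      by (simp only: right_diff_distrib swap_vars_mult swap_vars_of_int)
  qed
qed

lemma lookup_of_int_mult: "Poly_Mapping.lookup (of_int c * (f :: poly_Z)) a = c * Poly_Mapping.lookup f a"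
proof -
  have "of_int c * f = Poly_Mapping.map ((*) c) f"
    using mult_map_scale_conv_mult[of c f] by (simp only: of_int_eq_single)
  then show ?thesis by (simp add: map.rep_eq when_def)
qed

text \<open>Every letter carries a variable, so the constant term sees only the empty word.\<close>

lemma lookup_schub_fun_0: "Poly_Mapping.lookup (schub_fun n w) 0 = (if w = id then 1 else 0)"
proof -
  have X: "Poly_Mapping.lookup (X k * g) 0 = 0" for k g
  proof -
    have "Poly_Mapping.single k (1::nat) + b \<noteq> 0" for b
      by (metis add_is_0 lookup_add lookup_single_eq lookup_zero one_neq_zero)
    then have "0 \<notin> Poly_Mapping.keys (X k * g)"
      using keys_mult[of "X k" g] by (auto simp: X_def)
    then show ?thesis by (simp add: in_keys_iff)
  qed
  have fac: "Poly_Mapping.lookup (foldr (factor_op (X k)) is F w) 0 = Poly_Mapping.lookup (F w) 0" for k "is" F w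
    by (induction "is") (simp_all add: factor_op_def lookup_add X)
  have "Poly_Mapping.lookup (rows_op n ks F w) 0 = Poly_Mapping.lookup (F w) 0" for ks F
    by (induction ks arbitrary: F) (simp_all add: row_op_def fac)
  then show ?thesis by (simp add: schub_fun_def unit_fun_def)
qed

text \<open>The functional of \<open>w\<close> is the constant term after the divided differences
  along a reduced word of \<open>w\<close>. In the induction a descent \<open>i\<close> of
  \<open>w\<close> is stripped: \<open>divided_diff i\<close> kills the polynomials of
  \<open>v\<close> without a descent at \<open>i\<close> and otherwise passes to
  \<open>v s_i\<close>.\<close>

lemma dual_functional_exists:
  assumes "w \<in> Sym n"
  shows "\<exists>\<phi> :: poly_Z \<Rightarrow> int. (\<forall>f g. \<phi> (f + g) = \<phi> f + \<phi> g) \<and> (\<forall>c f. \<phi> (of_int c * f) = c * \<phi> f) \<and>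
    (\<forall>v\<in>Sym n. \<phi> (schub_fun n v) = (if v = w then 1 else 0))"
  using assms
proof (induction "card (invs w)" arbitrary: w rule: less_induct)
  case less
  show ?case
  proof (cases "w = id")
    case True
    then show ?thesis
      by (intro exI[of _ "\<lambda>f. Poly_Mapping.lookup f 0"])
        (simp add: lookup_schub_fun_0 lookup_add lookup_of_int_mult)
  next
    case False
    then obtain i where i: "1 \<le> i" "i < n" "w (Suc i) < w i"
      using Sym_no_descent[OF less.prems] Sym_ascent[OF less.prems] by blast
    have w': "w \<circ> simple_transp i \<in> Sym n" using i less.prems by (simp add: Sym_comp_simple_transp)
    have "card (invs (w \<circ> simple_transp i)) < card (invs w)"
      using card_invs_comp_simple_transp[OF less.prems i(3)] by simp
    from less.hyps[OF this w'] obtain \<phi> :: "poly_Z \<Rightarrow> int" where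
      \<phi>: "\<And>f g. \<phi> (f + g) = \<phi> f + \<phi> g" "\<And>c f. \<phi> (of_int c * f) = c * \<phi> f"
        "\<And>v. v \<in> Sym n \<Longrightarrow> \<phi> (schub_fun n v) = (if v = w \<circ> simple_transp i then 1 else 0)"
      by blast
    have zero: "\<phi> 0 = 0" using \<phi>(2)[of 0 0] by simp
    have "\<phi> (divided_diff i (schub_fun n v)) = (if v = w then 1 else 0)" if v: "v \<in> Sym n" for v
    proof (cases "v (Suc i) < v i")
      case True
      have "v \<circ> simple_transp i = w \<circ> simple_transp i \<longleftrightarrow> v = w"
        by (metis simple_transp_comp_involutory(2))
      then show ?thesis
        using True \<phi>(3)[of "v \<circ> simple_transp i"] v i
        by (simp add: divided_diff_schub_fun Sym_comp_simple_transp)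
    next
      case False
      then show ?thesis using i zero by (auto simp: divided_diff_schub_fun)
    qed
    then show ?thesis
      by (intro exI[of _ "\<lambda>f. \<phi> (divided_diff i f)"]) (simp add: divided_diff_linear \<phi>)
  qed
qed

section \<open>The span of the Schubert polynomials of a symmetric group\<close>

text \<open>Gaussian elimination without fractions: coordinate \<open>j0\<close> is cleared with a
  pivot row \<open>i0\<close> by cross-multiplication, and induction handles the remaining
  rows.\<close>

lemma integer_dependency:
  fixes A :: "'i \<Rightarrow> 'j \<Rightarrow> int"
  assumes "finite J" "finite I" "card J < card I"
  shows "\<exists>c. (\<exists>i\<in>I. c i \<noteq> 0) \<and> (\<forall>j\<in>J. (\<Sum>i\<in>I. c i * A i j) = 0)"
  using assms
proof (induction J arbitrary: I A rule: finite_induct)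
  case empty
  then have "I \<noteq> {}" by auto
  then show ?case by (intro exI[of _ "\<lambda>_. 1"]) auto
next
  case (insert j0 J)
  show ?case
  proof (cases "\<forall>i\<in>I. A i j0 = 0")
    case True
    have "card J < card I" using insert.hyps insert.prems by simp
    from insert.IH[OF insert.prems(1) this, of A] True show ?thesis by auto
  next
    case False
    then obtain i0 where i0: "i0 \<in> I" "A i0 j0 \<noteq> 0" by blast
    let ?I = "I - {i0}"
    have "card J < card ?I" using insert.hyps insert.prems i0 by simp
    from insert.IH[OF _ this, of "\<lambda>i j. A i0 j0 * A i j - A i j0 * A i0 j"] insert.prems
    obtain c where c: "\<exists>i\<in>?I. c i \<noteq> 0"
      "\<And>j. j \<in> J \<Longrightarrow> (\<Sum>i\<in>?I. c i * (A i0 j0 * A i j - A i j0 * A i0 j)) = 0" by auto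
    \<comment> \<open>The other coefficients are scaled by the pivot, and that of the pivot row is
      chosen to cancel coordinate \<open>j0\<close>.\<close>
    define d where "d i = (if i = i0 then - (\<Sum>i\<in>?I. c i * A i j0) else A i0 j0 * c i)" for i
    have sum_d: "(\<Sum>i\<in>I. d i * A i j) = (\<Sum>i\<in>?I. c i * (A i0 j0 * A i j - A i j0 * A i0 j))" for j
    proof -
      have "(\<Sum>i\<in>I. d i * A i j) = d i0 * A i0 j + (\<Sum>i\<in>?I. d i * A i j)"
        using insert.prems i0 by (simp add: sum.remove)
      also have "(\<Sum>i\<in>?I. d i * A i j) = (\<Sum>i\<in>?I. A i0 j0 * c i * A i j)"
        by (rule sum.cong) (auto simp: d_def)
      finally have split: "(\<Sum>i\<in>I. d i * A i j) = d i0 * A i0 j + (\<Sum>i\<in>?I. A i0 j0 * c i * A i j)" .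
      have d_i0: "d i0 = - (\<Sum>i\<in>?I. c i * A i j0)" by (simp add: d_def)
      show ?thesis
        unfolding split d_i0
        by (simp add: sum_distrib_left sum_distrib_right sum_subtractf right_diff_distrib mult_ac)
    qed
    have "(\<Sum>i\<in>I. d i * A i j) = 0" if "j \<in> insert j0 J" for j
      unfolding sum_d using that c(2) by (auto simp: mult.commute)
    moreover have "\<exists>i\<in>I. d i \<noteq> 0" using c(1) i0 by (auto simp: d_def)
    ultimately show ?thesis by blast
  qed
qed

lemma additive_sum:
  fixes \<phi> :: "poly_Z \<Rightarrow> int"
  assumes "\<And>f g. \<phi> (f + g) = \<phi> f + \<phi> g" "\<And>c f. \<phi> (of_int c * f) = c * \<phi> f" "finite T"
  shows "\<phi> (\<Sum>v\<in>T. of_int (c v) * g v) = (\<Sum>v\<in>T. c v * \<phi> (g v))"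
  using assms(3) assms(2)[of 0 0] by induction (auto simp: assms(1,2))

lemma dual_family_exists:
  "\<exists>\<Phi> :: (nat \<Rightarrow> nat) \<Rightarrow> poly_Z \<Rightarrow> int. \<forall>w\<in>Sym n.
     (\<forall>c f. \<Phi> w (of_int c * f) = c * \<Phi> w f) \<and> (\<forall>f g. \<Phi> w (f + g) = \<Phi> w f + \<Phi> w g) \<and>
     (\<forall>T c. T \<subseteq> Sym n \<longrightarrow>
       \<Phi> w (\<Sum>v\<in>T. of_int (c v) * schub_fun n v) = (if w \<in> T then c w else 0))"
proof -
  have "\<forall>w\<in>Sym n. \<exists>\<phi> :: poly_Z \<Rightarrow> int. (\<forall>c f. \<phi> (of_int c * f) = c * \<phi> f) \<and>
     (\<forall>f g. \<phi> (f + g) = \<phi> f + \<phi> g) \<and>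
     (\<forall>T c. T \<subseteq> Sym n \<longrightarrow>
       \<phi> (\<Sum>v\<in>T. of_int (c v) * schub_fun n v) = (if w \<in> T then c w else 0))"
  proof
    fix w assume "w \<in> Sym n"
    from dual_functional_exists[OF this] obtain \<phi> :: "poly_Z \<Rightarrow> int" where
      \<phi>: "\<And>f g. \<phi> (f + g) = \<phi> f + \<phi> g" "\<And>c f. \<phi> (of_int c * f) = c * \<phi> f"
        "\<And>v. v \<in> Sym n \<Longrightarrow> \<phi> (schub_fun n v) = (if v = w then 1 else 0)" by blast
    have "\<phi> (\<Sum>v\<in>T. of_int (c v) * schub_fun n v) = (if w \<in> T then c w else 0)"
      if T: "T \<subseteq> Sym n" for T c
    proof -
      have fin: "finite T" using T finite_Sym finite_subset by blast
      have "\<phi> (\<Sum>v\<in>T. of_int (c v) * schub_fun n v) = (\<Sum>v\<in>T. c v * \<phi> (schub_fun n v))"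
        by (rule additive_sum[OF \<phi>(1,2) fin])
      also have "\<dots> = (\<Sum>v\<in>T. if w = v then c v else 0)"
        by (rule sum.cong) (use T \<phi>(3) in auto)
      also have "\<dots> = (if w \<in> T then c w else 0)"
        using fin by (simp add: sum.delta')
      finally show ?thesis .
    qed
    with \<phi>(1,2) show "\<exists>\<phi> :: poly_Z \<Rightarrow> int. (\<forall>c f. \<phi> (of_int c * f) = c * \<phi> f) \<and>
     (\<forall>f g. \<phi> (f + g) = \<phi> f + \<phi> g) \<and>
     (\<forall>T c. T \<subseteq> Sym n \<longrightarrow>
       \<phi> (\<Sum>v\<in>T. of_int (c v) * schub_fun n v) = (if w \<in> T then c w else 0))"
      by blast
  qed
  then show ?thesis by (rule bchoice)
qed

text \<open>The exponent vectors below the staircase \<open>(n-1, n-2, ..., 0)\<close>; truncated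
  subtraction forces the exponents beyond \<open>n\<close> to be zero.\<close>

definition exps_box :: "nat \<Rightarrow> (nat \<Rightarrow>\<^sub>0 nat) set" where
  "exps_box n = {a. Poly_Mapping.lookup a 0 = 0 \<and> (\<forall>i\<ge>1. Poly_Mapping.lookup a i \<le> n - i)}"

lemma exps_box_card: "finite (exps_box n)" "card (exps_box n) \<le> fact n"
proof -
  let ?P = "PiE {1..n} (\<lambda>i. {..n - i})"
  let ?r = "\<lambda>a :: nat \<Rightarrow>\<^sub>0 nat. restrict (Poly_Mapping.lookup a) {1..n}"
  have inj: "inj_on ?r (exps_box n)"
  proof (rule inj_onI, rule poly_mapping_eqI)
    fix a b i assume a: "a \<in> exps_box n" and b: "b \<in> exps_box n" and eq: "?r a = ?r b"
    show "Poly_Mapping.lookup a i = Poly_Mapping.lookup b i"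
    proof (cases "i \<in> {1..n}")
      case True
      then show ?thesis using fun_cong[OF eq, of i] by simp
    next
      case False
      show ?thesis
      proof (cases "i = 0")
        case True
        then show ?thesis using a b by (simp add: exps_box_def)
      next
        case nonzero: False
        then have "Poly_Mapping.lookup a i \<le> n - i" "Poly_Mapping.lookup b i \<le> n - i"
          using a b by (auto simp: exps_box_def)
        with False nonzero show ?thesis by auto
      qed
    qed
  qed
  have sub: "?r ` exps_box n \<subseteq> ?P" by (auto simp: exps_box_def)
  have fin: "finite ?P" by (rule finite_PiE) auto
  then show "finite (exps_box n)" using inj sub finite_imageD finite_subset by metis
  have "card (exps_box n) \<le> card ?P"
    by (rule card_inj_on_le[OF inj sub fin])
  also have "card ?P = (\<Prod>i=1..n. Suc (n - i))" by (simp add: card_PiE)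
  also have "\<dots> = (\<Prod>i=1..n. Suc (n - (n + 1 - i)))"
    by (subst prod.atLeastAtMost_rev) simp
  also have "\<dots> = (\<Prod>i=1..n. i)" by (rule prod.cong) auto
  also have "\<dots> = fact n" by (simp add: fact_prod)
  finally show "card (exps_box n) \<le> fact n" .
qed

definition exp_bounded :: "nat \<Rightarrow> poly_Z \<Rightarrow> bool" where
  "exp_bounded n f \<longleftrightarrow> deg_le 0 0 f \<and> (\<forall>i\<ge>1. deg_le i (n - i) f)"

lemma exp_bounded_iff: "exp_bounded n f \<longleftrightarrow> Poly_Mapping.keys f \<subseteq> exps_box n"
  by (auto simp: exp_bounded_def deg_le_def exps_box_def)

lemma exp_bounded_schub_fun: "exp_bounded n (schub_fun n w)"
  by (auto simp: exp_bounded_def deg_le_schub_fun_0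
      intro: deg_le_mono[OF deg_le_schub_fun nonrec_count_le])

text \<open>The \<open>n!\<close> Schubert polynomials together with \<open>f\<close> exceed the number of exponent vectors in the box, so
  they satisfy a nontrivial integer relation; the dual functionals show that the coefficient of \<open>f\<close>
  divides all the others.\<close>

lemma exp_bounded_schub_fun_span:
  assumes f: "exp_bounded n f"
  shows "\<exists>d. f = (\<Sum>w\<in>Sym n. of_int (d w) * schub_fun n w)"
proof -
  from dual_family_exists[of n] obtain \<Phi> :: "(nat \<Rightarrow> nat) \<Rightarrow> poly_Z \<Rightarrow> int" where
    dual: "\<forall>w\<in>Sym n.
     (\<forall>c f. \<Phi> w (of_int c * f) = c * \<Phi> w f) \<and> (\<forall>f g. \<Phi> w (f + g) = \<Phi> w f + \<Phi> w g) \<and>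
     (\<forall>T c. T \<subseteq> Sym n \<longrightarrow>
       \<Phi> w (\<Sum>v\<in>T. of_int (c v) * schub_fun n v) = (if w \<in> T then c w else 0))" ..
  have \<Phi>: "\<Phi> w (of_int c * f) = c * \<Phi> w f" "\<Phi> w (f + g) = \<Phi> w f + \<Phi> w g"
      "\<Phi> w (\<Sum>v\<in>Sym n. of_int (d v) * schub_fun n v) = d w"
    if "w \<in> Sym n" for w c d f g
    using bspec[OF dual that] that by simp_all
  let ?I = "insert None (Some ` Sym n)"
  let ?g = "\<lambda>i. case i of None \<Rightarrow> f | Some w \<Rightarrow> schub_fun n w"
  have "card (Sym n) = fact n" unfolding Sym_def by (rule card_permutations) auto
  then have "card (exps_box n) < card ?I"
    using exps_box_card(2)[of n] by (simp add: finite_Sym card_image card_insert_if)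
  from integer_dependency[OF exps_box_card(1) _ this, of "\<lambda>i. Poly_Mapping.lookup (?g i)"]
  obtain c where c: "\<exists>i\<in>?I. c i \<noteq> 0"
    "\<And>a. a \<in> exps_box n \<Longrightarrow> (\<Sum>i\<in>?I. c i * Poly_Mapping.lookup (?g i) a) = 0"
    by (auto simp: finite_Sym)
  have keys: "Poly_Mapping.lookup (?g i) a = 0" if "a \<notin> exps_box n" for i a
  proof -
    have "Poly_Mapping.keys (?g i) \<subseteq> exps_box n"
      using f exp_bounded_schub_fun[of n] by (cases i) (simp_all add: exp_bounded_iff)
    with that show ?thesis using in_keys_iff[of a "?g i"] by blast
  qed
  have "(\<Sum>i\<in>?I. of_int (c i) * ?g i) = 0"
  proof (rule poly_mapping_eqI)
    fix a
    show "Poly_Mapping.lookup (\<Sum>i\<in>?I. of_int (c i) * ?g i) a = Poly_Mapping.lookup 0 a"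
      using c(2)[of a] keys[of a] by (cases "a \<in> exps_box n") (simp_all add: lookup_sum lookup_of_int_mult)
  qed
  then have dep: "of_int (c None) * f + (\<Sum>w\<in>Sym n. of_int (c (Some w)) * schub_fun n w) = 0"
    by (simp add: finite_Sym sum.reindex)
  have coeff: "c (Some w) = - c None * \<Phi> w f" if w: "w \<in> Sym n" for w
  proof -
    have "\<Phi> w (of_int (c None) * f + (\<Sum>w\<in>Sym n. of_int (c (Some w)) * schub_fun n w)) = \<Phi> w 0"
      using dep by simp
    also have "\<Phi> w 0 = 0" using \<Phi>(1)[OF w, of 0 0] by simp
    finally show ?thesis by (simp add: \<Phi> w)
  qed
  \<comment> \<open>If this vanished, \<open>coeff\<close> would make the whole relation
    trivial.\<close>
  have N: "c None \<noteq> 0" using c(1) coeff by auto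
  have "of_int (c None) * (f - (\<Sum>w\<in>Sym n. of_int (\<Phi> w f) * schub_fun n w)) = 0"
    using dep by (simp add: coeff right_diff_distrib sum_distrib_left sum_negf mult.assoc)
  then have "f = (\<Sum>w\<in>Sym n. of_int (\<Phi> w f) * schub_fun n w)"
    using N by simp
  then show ?thesis by (rule exI[of _ "\<lambda>w. \<Phi> w f"])
qed

lemma schub_fun_independent:
  assumes "T \<subseteq> Sym n" "T' \<subseteq> Sym n" "w \<in> Sym n"
    and "(\<Sum>v\<in>T. of_int (c v) * schub_fun n v) = (\<Sum>v\<in>T'. of_int (c' v) * schub_fun n v)"
  shows "(if w \<in> T then c w else 0) = (if w \<in> T' then c' w else (0::int))"
proof -
  from dual_family_exists[of n] obtain \<Phi> :: "(nat \<Rightarrow> nat) \<Rightarrow> poly_Z \<Rightarrow> int" where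
    dual: "\<forall>w\<in>Sym n.
     (\<forall>c f. \<Phi> w (of_int c * f) = c * \<Phi> w f) \<and> (\<forall>f g. \<Phi> w (f + g) = \<Phi> w f + \<Phi> w g) \<and>
     (\<forall>T c. T \<subseteq> Sym n \<longrightarrow>
       \<Phi> w (\<Sum>v\<in>T. of_int (c v) * schub_fun n v) = (if w \<in> T then c w else 0))" ..
  have "\<Phi> w (\<Sum>v\<in>T. of_int (c v) * schub_fun n v) = (if w \<in> T then c w else 0)"
    if "T \<subseteq> Sym n" for T c
    using bspec[OF dual assms(3)] that by simp
  from this[OF assms(1), of c] this[OF assms(2), of c'] assms(4) show ?thesis by simp
qed

lemma Sym_inf_iff: "w \<in> Sym_inf \<longleftrightarrow> (\<exists>n. w \<in> Sym n)"
proof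
  assume w: "w \<in> Sym_inf"
  then have "finite {j. w j \<noteq> j}" by (simp add: Sym_inf_def)
  then obtain N where "\<forall>j\<in>{j. w j \<noteq> j}. j \<le> N"
    unfolding finite_nat_set_iff_bounded_le ..
  then have N: "w j = j" if "N < j" for j using that by force
  have "w permutes {1..N}"
  proof (rule permutes_superset)
    show "w permutes {1..}" using w by (simp add: Sym_inf_def)
  qed (use N in auto)
  then show "\<exists>n. w \<in> Sym n" by (auto simp: Sym_def)
next
  assume "\<exists>n. w \<in> Sym n"
  then obtain n where w: "w permutes {1..n}" by (auto simp: Sym_def)
  have "{j. w j \<noteq> j} \<subseteq> {1..n}" using permutes_not_in[OF w] by blast
  moreover have "w permutes {1..}" using w by (rule permutes_subset) auto
  ultimately show "w \<in> Sym_inf" unfolding Sym_inf_def using finite_subset by blast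
qed

lemma finite_subset_Sym:
  assumes "finite T" "T \<subseteq> Sym_inf"
  shows "\<exists>N\<ge>m. T \<subseteq> Sym N"
  using assms
proof (induction T rule: finite_induct)
  case (insert w T)
  then obtain N k where "N \<ge> m" "T \<subseteq> Sym N" "w \<in> Sym k" by (auto simp: Sym_inf_iff)
  then have "max N k \<ge> m" "insert w T \<subseteq> Sym (max N k)"
    using Sym_mono[of N "max N k"] Sym_mono[of k "max N k"] by auto
  then show ?case by blast
qed auto

section \<open>Schubert structure constants and forward stability\<close>

text \<open>The predicate under the definite description of \<open>schubert_coeff\<close>, for an
  arbitrary polynomial in place of the product.\<close>

definition is_schubert_expansion :: "poly_Z \<Rightarrow> ((nat \<Rightarrow> nat) \<Rightarrow> int) \<Rightarrow> bool" where
  "is_schubert_expansion f c \<longleftrightarrow> finite {w. c w \<noteq> 0} \<and> {w. c w \<noteq> 0} \<subseteq> Sym_inf \<and>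
     f = (\<Sum>w\<in>{w. c w \<noteq> 0}. of_int (c w) * schubert w)"

lemma schubert_expansion_unique:
  assumes "is_schubert_expansion f c" "is_schubert_expansion f c'"
  shows "c = c'"
proof
  fix w
  let ?S = "{w. c w \<noteq> 0}" and ?S' = "{w. c' w \<noteq> 0}"
  obtain N where N: "N \<ge> 1" "?S \<union> ?S' \<subseteq> Sym N"
    using finite_subset_Sym[of "?S \<union> ?S'" 1] assms by (auto simp: is_schubert_expansion_def)
  have "(\<Sum>w\<in>?S. of_int (c w) * schubert w) = (\<Sum>w\<in>?S. of_int (c w) * schub_fun N w)"
    "(\<Sum>w\<in>?S'. of_int (c' w) * schubert w) = (\<Sum>w\<in>?S'. of_int (c' w) * schub_fun N w)"
    using N by (auto intro!: sum.cong simp: schubert_eq_schub_fun subset_iff)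
  then have eq: "(\<Sum>w\<in>?S. of_int (c w) * schub_fun N w) = (\<Sum>w\<in>?S'. of_int (c' w) * schub_fun N w)"
    using assms by (simp add: is_schubert_expansion_def)
  show "c w = c' w"
  proof (cases "w \<in> Sym N")
    case True
    then show ?thesis using schub_fun_independent[OF _ _ True eq] N by (auto split: if_splits)
  next
    case False
    then have "w \<notin> ?S" "w \<notin> ?S'" using N by blast+
    then show ?thesis by simp
  qed
qed

lemma schubert_expansion_exists:
  assumes "exp_bounded m f" "1 \<le> m"
  shows "\<exists>c. is_schubert_expansion f c \<and> {w. c w \<noteq> 0} \<subseteq> Sym m"
proof -
  from exp_bounded_schub_fun_span[OF assms(1)] obtain d where
    d: "f = (\<Sum>w\<in>Sym m. of_int (d w) * schub_fun m w)" by blast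
  define c where "c w = (if w \<in> Sym m then d w else 0)" for w
  have sub: "{w. c w \<noteq> 0} \<subseteq> Sym m" by (auto simp: c_def)
  have "f = (\<Sum>w\<in>Sym m. of_int (c w) * schubert w)"
    unfolding d by (rule sum.cong) (simp_all add: c_def schubert_eq_schub_fun[OF _ assms(2)])
  also have "\<dots> = (\<Sum>w\<in>{w. c w \<noteq> 0}. of_int (c w) * schubert w)"
    using sub by (intro sum.mono_neutral_right) (auto simp: finite_Sym)
  finally have "f = (\<Sum>w\<in>{w. c w \<noteq> 0}. of_int (c w) * schubert w)" .
  moreover have "{w. c w \<noteq> 0} \<subseteq> Sym_inf" using sub Sym_inf_iff by blast
  ultimately have "is_schubert_expansion f c"
    using finite_subset[OF sub finite_Sym] by (simp add: is_schubert_expansion_def)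
  with sub show ?thesis by blast
qed

text \<open>By uniqueness the given expansion is the one found inside \<open>Sym m\<close>. Together
  with \<open>exp_bounded_expansion\<close> this translates \<open>FS\<close> into degree
  bounds.\<close>

lemma schubert_expansion_support:
  assumes "exp_bounded m f" "1 \<le> m" "is_schubert_expansion f c"
  shows "{w. c w \<noteq> 0} \<subseteq> Sym m"
  using schubert_expansion_exists[OF assms(1,2)] schubert_expansion_unique[OF assms(3)] by blast

lemma exp_bounded_add: "exp_bounded m f \<Longrightarrow> exp_bounded m g \<Longrightarrow> exp_bounded m (f + g)"
  by (simp add: exp_bounded_def deg_le_add)

lemma exp_bounded_of_int_mult: "exp_bounded m f \<Longrightarrow> exp_bounded m (of_int c * f)"
  by (auto simp: exp_bounded_iff in_keys_iff lookup_of_int_mult subset_iff)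

lemma exp_bounded_expansion:
  assumes "is_schubert_expansion f c" "1 \<le> m" "{w. c w \<noteq> 0} \<subseteq> Sym m"
  shows "exp_bounded m f"
proof -
  have "exp_bounded m (\<Sum>w\<in>T. of_int (c w) * schubert w)" if "finite T" "T \<subseteq> Sym m" for T
    using that
  proof (induction T rule: finite_induct)
    case empty
    then show ?case by (simp add: exp_bounded_iff)
  next
    case (insert w T)
    then have "exp_bounded m (schubert w)"
      using assms(2) exp_bounded_schub_fun[of m w] schubert_eq_schub_fun[of w m] by simp
    with insert show ?case by (simp add: exp_bounded_add exp_bounded_of_int_mult)
  qed
  then show ?thesis using assms by (simp add: is_schubert_expansion_def)
qed

text \<open>The part of top degree in \<open>x_i\<close> is multiplicative, and the polynomial ring is a domain.\<close>

lemma deg_le_mult_cancel: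
  assumes fg: "deg_le i d (f * g)" and g: "g \<noteq> 0"
  shows "deg_le i d f"
proof (rule ccontr)
  assume nf: "\<not> deg_le i d f"
  then have "f \<noteq> 0" by auto
  define D where "D h = Max ((\<lambda>a. Poly_Mapping.lookup a i) ` Poly_Mapping.keys h)" for h :: poly_Z
  define top where "top h = Poly_Mapping.mapp (\<lambda>a c. if Poly_Mapping.lookup a i = D h then c else 0) h"
    for h :: poly_Z
  have D_le: "Poly_Mapping.lookup a i \<le> D h" if "a \<in> Poly_Mapping.keys h" for a h
    unfolding D_def using that by (intro Max_ge) auto
  have top_keys: "Poly_Mapping.lookup a i = D h" if "a \<in> Poly_Mapping.keys (top h)" for a h
    using that by (auto simp: top_def in_keys_iff lookup_mapp when_def split: if_splits)
  have rest_keys: "Poly_Mapping.lookup a i < D h" if "a \<in> Poly_Mapping.keys (h - top h)" for a h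
  proof -
    have "Poly_Mapping.lookup (h - top h) a \<noteq> 0" using that by (simp add: in_keys_iff)
    then have "a \<in> Poly_Mapping.keys h" "Poly_Mapping.lookup a i \<noteq> D h"
      by (auto simp: top_def lookup_minus lookup_mapp in_keys_iff when_def split: if_splits)
    then show ?thesis using D_le[of a h] by simp
  qed
  have top_nz: "top h \<noteq> 0" if "h \<noteq> 0" for h
  proof -
    have "D h \<in> (\<lambda>a. Poly_Mapping.lookup a i) ` Poly_Mapping.keys h"
      unfolding D_def using that by (intro Max_in) auto
    then obtain a where "a \<in> Poly_Mapping.keys h" "Poly_Mapping.lookup a i = D h" by auto
    then have "Poly_Mapping.lookup (top h) a \<noteq> 0"
      by (simp add: top_def lookup_mapp in_keys_iff)
    then show ?thesis by auto
  qed
  \<comment> \<open>A monomial \<open>k\<close> of this product has degree \<open>D f + D g\<close>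
    in \<open>x_i\<close>; all other terms of \<open>f * g\<close> have smaller degree there, so
    \<open>k\<close> survives.\<close>
  have "top f * top g \<noteq> 0" using top_nz \<open>f \<noteq> 0\<close> g by simp
  then obtain k where k: "k \<in> Poly_Mapping.keys (top f * top g)"
    using keys_eq_empty by blast
  then have k_deg: "Poly_Mapping.lookup k i = D f + D g"
    using keys_mult[of "top f" "top g"] top_keys by (auto simp: lookup_add)
  have "k \<notin> Poly_Mapping.keys (top f * (g - top g))"
  proof
    assume "k \<in> Poly_Mapping.keys (top f * (g - top g))"
    then obtain a b where "a \<in> Poly_Mapping.keys (top f)" "b \<in> Poly_Mapping.keys (g - top g)" "k = a + b"
      using keys_mult[of "top f" "g - top g"] by blast
    then show False using top_keys[of a f] rest_keys[of b g] k_deg by (simp add: lookup_add)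
  qed
  moreover have "k \<notin> Poly_Mapping.keys ((f - top f) * g)"
  proof
    assume "k \<in> Poly_Mapping.keys ((f - top f) * g)"
    then obtain a b where "a \<in> Poly_Mapping.keys (f - top f)" "b \<in> Poly_Mapping.keys g" "k = a + b"
      using keys_mult[of "f - top f" g] by blast
    then show False using D_le[of b g] rest_keys[of a f] k_deg by (simp add: lookup_add)
  qed
  moreover have "f * g = top f * top g + top f * (g - top g) + (f - top f) * g"
    by (simp add: algebra_simps)
  ultimately have "k \<in> Poly_Mapping.keys (f * g)"
    using k by (simp add: in_keys_iff lookup_add)
  then have "D f \<le> d" using fg k_deg by (auto simp: deg_le_def)
  then have "deg_le i d f" using D_le order_trans unfolding deg_le_def by blast
  with nf show False ..
qed

lemma exp_bounded_mult_cancel: "exp_bounded m (f * g) \<Longrightarrow> g \<noteq> 0 \<Longrightarrow> exp_bounded m f"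
  unfolding exp_bounded_def using deg_le_mult_cancel by blast

lemma schubert_expansion_schubert:
  assumes "u \<in> Sym_inf"
  shows "is_schubert_expansion (schubert u) (\<lambda>w. if w = u then 1 else 0)"
  using assms by (simp add: is_schubert_expansion_def)

lemma schubert_neq_0:
  assumes "u \<in> Sym_inf"
  shows "schubert u \<noteq> 0"
proof
  assume "schubert u = 0"
  then have "is_schubert_expansion (schubert u) (\<lambda>w. 0)" by (simp add: is_schubert_expansion_def)
  from fun_cong[OF schubert_expansion_unique[OF this schubert_expansion_schubert[OF assms]], of u]
  show False by simp
qed

lemma is_schubert_expansion_coeff:
  assumes "u \<in> Sym_inf" "v \<in> Sym_inf"
  shows "is_schubert_expansion (schubert u * schubert v) (schubert_coeff u v)"
proof -
  obtain n where n: "n \<ge> 1" "{u, v} \<subseteq> Sym n"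
    using finite_subset_Sym[of "{u, v}" 1] assms by auto
  then have sch: "schubert u = schub_fun n u" "schubert v = schub_fun n v"
    by (auto intro: schubert_eq_schub_fun)
  \<comment> \<open>Rank \<open>2 * n\<close> suffices because two degrees of at most
    \<open>n - i\<close> add up to at most \<open>2 * n - i\<close>.\<close>
  have "exp_bounded (2 * n) (schubert u * schubert v)"
    unfolding exp_bounded_def
  proof (intro conjI allI impI)
    show "deg_le 0 0 (schubert u * schubert v)"
      using deg_le_mult[OF deg_le_schub_fun_0 deg_le_schub_fun_0] by (simp add: sch)
    fix i :: nat assume "1 \<le> i"
    then show "deg_le i (2 * n - i) (schubert u * schubert v)"
      using deg_le_mult[OF deg_le_schub_fun deg_le_schub_fun, of i n u n v]
        nonrec_count_le[of i n u] nonrec_count_le[of i n v]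
      by (auto simp: sch intro: deg_le_mono)
  qed
  then obtain c where c: "is_schubert_expansion (schubert u * schubert v) c"
    using schubert_expansion_exists[of "2 * n"] n by auto
  have "schubert_coeff u v = (THE c. is_schubert_expansion (schubert u * schubert v) c)"
    by (simp add: schubert_coeff_def is_schubert_expansion_def)
  also have "\<dots> = c"
    using c schubert_expansion_unique by blast
  finally show ?thesis using c by simp
qed

section \<open>Bounds on forward stability\<close>

lemma FS_le:
  assumes "u \<in> Sym_inf" "v \<in> Sym_inf" "1 \<le> m" "exp_bounded m (schubert u * schubert v)"
  shows "FS u v \<le> m"
  unfolding FS_def
  using schubert_expansion_support[OF assms(4,3) is_schubert_expansion_coeff[OF assms(1,2)]] assms(3)
  by (intro Least_le) blast

text \<open>The minimum exists since the support is finite. The product then satisfies the degree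
  bounds of rank \<open>FS u v\<close>; its factor \<open>schubert u\<close> inherits them, and the
  expansion of that factor is supported at \<open>u\<close> alone.\<close>

lemma FS_props:
  assumes "u \<in> Sym_inf" "v \<in> Sym_inf"
  shows "1 \<le> FS u v" "u \<in> Sym (FS u v)"
proof -
  note exp = is_schubert_expansion_coeff[OF assms]
  let ?S = "{w. schubert_coeff u v w \<noteq> 0}"
  obtain N where "N \<ge> 1" "?S \<subseteq> Sym N"
    using finite_subset_Sym[of ?S 1] exp unfolding is_schubert_expansion_def by blast
  then have "1 \<le> N \<and> (\<forall>w\<in>Sym_inf. schubert_coeff u v w \<noteq> 0 \<longrightarrow> w \<in> Sym N)" by blast
  then have FS: "1 \<le> FS u v \<and> (\<forall>w\<in>Sym_inf. schubert_coeff u v w \<noteq> 0 \<longrightarrow> w \<in> Sym (FS u v))"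
    unfolding FS_def by (rule LeastI)
  then show "1 \<le> FS u v" by simp
  have "?S \<subseteq> Sym_inf" using exp by (simp add: is_schubert_expansion_def)
  then have "?S \<subseteq> Sym (FS u v)" using FS by blast
  then have "exp_bounded (FS u v) (schubert u * schubert v)"
    using FS exp by (intro exp_bounded_expansion) auto
  then have "exp_bounded (FS u v) (schubert u)"
    by (rule exp_bounded_mult_cancel) (rule schubert_neq_0[OF assms(2)])
  from schubert_expansion_support[OF this _ schubert_expansion_schubert[OF assms(1)]] FS
  show "u \<in> Sym (FS u v)" by (auto split: if_splits)
qed

text \<open>Exceeding \<open>n\<close> by the largest excess of a degree of the product over
  \<open>n - i\<close> is enough. The sum of the excesses dominates this maximum and is linear under
  expectation.\<close>

lemma FS_upper_bound:
  assumes "u \<in> Sym n" "v \<in> Sym n" "1 \<le> n"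
  shows "FS u v \<le> n + (\<Sum>i=1..<n. nonrec_count i n u + nonrec_count i n v - (n - i))"
proof (rule FS_le)
  let ?m = "n + (\<Sum>i=1..<n. nonrec_count i n u + nonrec_count i n v - (n - i))"
  show "u \<in> Sym_inf" "v \<in> Sym_inf" using assms by (auto simp: Sym_inf_iff)
  show "1 \<le> ?m" using assms by simp
  have sch: "schubert u = schub_fun n u" "schubert v = schub_fun n v"
    using assms by (auto intro: schubert_eq_schub_fun)
  show "exp_bounded ?m (schubert u * schubert v)"
    unfolding exp_bounded_def
  proof (intro conjI allI impI)
    show "deg_le 0 0 (schubert u * schubert v)"
      using deg_le_mult[OF deg_le_schub_fun_0 deg_le_schub_fun_0] by (simp add: sch)
    fix i :: nat assume i: "1 \<le> i"
    have "nonrec_count i n u + nonrec_count i n v \<le> ?m - i"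
    proof (cases "i < n")
      case True
      then have "nonrec_count i n u + nonrec_count i n v - (n - i) \<le>
          (\<Sum>i=1..<n. nonrec_count i n u + nonrec_count i n v - (n - i))"
        using i by (intro member_le_sum) auto
      with True show ?thesis by linarith
    next
      case False
      then show ?thesis using nonrec_count_le[of i n u] nonrec_count_le[of i n v] by simp
    qed
    then show "deg_le i (?m - i) (schubert u * schubert v)"
      using deg_le_mult[OF deg_le_schub_fun deg_le_schub_fun, of i n u n v] i
      by (auto simp: sch intro: deg_le_mono)
  qed
qed

section \<open>Boolean permutations\<close>

definition word_perm :: "nat list \<Rightarrow> nat \<Rightarrow> nat" where
  "word_perm is = foldr (\<circ>) (map simple_transp is) id"

lemma word_perm_simps [simp]:
  "word_perm [] = id"
  "word_perm (i # is) = simple_transp i \<circ> word_perm is"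
  by (simp_all add: word_perm_def)

lemma word_perm_append: "word_perm (is @ js) = word_perm is \<circ> word_perm js"
  by (induction "is") (simp_all add: comp_assoc)

lemma word_perm_in_Sym: "set is \<subseteq> {1..<n} \<Longrightarrow> word_perm is \<in> Sym n"
proof (induction "is")
  case Nil
  then show ?case by (simp only: word_perm_simps id_in_Sym)
next
  case (Cons i "is")
  then have "simple_transp i \<in> Sym n" "word_perm is \<in> Sym n"
    by (simp_all add: simple_transp_in_Sym)
  then show ?case unfolding word_perm_simps by (rule Sym_comp)
qed

lemma in_boolean_perms_iff:
  "w \<in> boolean_perms n \<longleftrightarrow> (\<exists>is. distinct is \<and> set is \<subseteq> {1..<n} \<and> w = word_perm is)"
  unfolding boolean_perms_def word_perm_def[symmetric] using word_perm_in_Sym by blast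

lemma boolean_perms_subset_Sym: "boolean_perms n \<subseteq> Sym n"
  by (auto simp: boolean_perms_def)

lemma finite_boolean_perms: "finite (boolean_perms n)"
  using finite_subset[OF boolean_perms_subset_Sym finite_Sym] .

lemma id_in_boolean_perms: "id \<in> boolean_perms n"
  unfolding in_boolean_perms_iff by (intro exI[of _ "[]"]) simp

lemma boolean_perms_mono: "m \<le> n \<Longrightarrow> boolean_perms m \<subseteq> boolean_perms n"
proof
  fix w assume "m \<le> n" "w \<in> boolean_perms m"
  then obtain "is" where "distinct is" "set is \<subseteq> {1..<m}" "w = word_perm is"
    unfolding in_boolean_perms_iff by blast
  moreover have "{1..<m} \<subseteq> {1..<n}" using \<open>m \<le> n\<close> by auto
  ultimately show "w \<in> boolean_perms n" unfolding in_boolean_perms_iff by blast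
qed

lemma simple_transp_word_perm_commute:
  assumes "\<And>j. j \<in> set is \<Longrightarrow> Suc j < n"
  shows "simple_transp n \<circ> word_perm is = word_perm is \<circ> simple_transp n"
  using assms
proof (induction "is")
  case (Cons j js)
  have "simple_transp n \<circ> simple_transp j = simple_transp j \<circ> simple_transp n"
    using Cons.prems[of j] by (auto simp: fun_eq_iff simple_transp_apply)
  then have "simple_transp n \<circ> word_perm (j # js) = simple_transp j \<circ> (simple_transp n \<circ> word_perm js)"
    unfolding word_perm_simps by (metis comp_assoc)
  also have "\<dots> = simple_transp j \<circ> (word_perm js \<circ> simple_transp n)"
    using Cons by (metis list.set_intros(2))
  finally show ?case unfolding word_perm_simps comp_assoc .
qed (simp only: word_perm_simps id_comp comp_id)

text \<open>\<open>s_n\<close> commutes with every other letter except \<open>s_{n-1}\<close>, which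
  occurs on at most one side of it, so \<open>s_n\<close> can be moved to the opposite end of the
  word.\<close>

lemma boolean_perms_Suc:
  assumes "1 \<le> n"
  shows "boolean_perms (Suc n) = boolean_perms n \<union> (\<lambda>v. v \<circ> simple_transp n) ` boolean_perms n \<union>
    (\<lambda>v. simple_transp n \<circ> v) ` boolean_perms n" (is "_ = ?R")
proof (intro equalityI subsetI)
  fix w assume "w \<in> boolean_perms (Suc n)"
  then obtain "is" where w: "distinct is" "set is \<subseteq> {1..<Suc n}" "w = word_perm is"
    unfolding in_boolean_perms_iff by blast
  show "w \<in> ?R"
  proof (cases "n \<in> set is")
    case False
    then have "set is \<subseteq> {1..<n}" using w(2) less_Suc_eq by fastforce
    then have "w \<in> boolean_perms n" using w unfolding in_boolean_perms_iff by blast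
    then show ?thesis by blast
  next
    case True
    then obtain as bs where "is": "is = as @ n # bs" by (meson split_list)
    have word: "word_perm is = word_perm as \<circ> (simple_transp n \<circ> word_perm bs)"
      unfolding "is" word_perm_append word_perm_simps ..
    have small: "j < n" if "j \<in> set (as @ bs)" for j
    proof -
      have "j \<noteq> n" using w(1) that by (auto simp: "is")
      then show ?thesis using that w(2) by (auto simp: "is")
    qed
    then have v: "word_perm (as @ bs) \<in> boolean_perms n"
      unfolding in_boolean_perms_iff using w(1,2) by (intro exI[of _ "as @ bs"]) (auto simp: "is")
    show ?thesis
    proof (cases "n - 1 \<in> set bs")
      case False
      have "Suc j < n" if "j \<in> set bs" for j
        using small[of j] that False by (cases "Suc j = n") auto
      then have "w = word_perm (as @ bs) \<circ> simple_transp n"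
        unfolding w(3) word word_perm_append by (simp only: simple_transp_word_perm_commute comp_assoc)
      then show ?thesis using v by blast
    next
      case True
      then have "n - 1 \<notin> set as" using w(1) by (auto simp: "is")
      then have "Suc j < n" if "j \<in> set as" for j
        using small[of j] that by (cases "Suc j = n") auto
      then have "simple_transp n \<circ> word_perm as = word_perm as \<circ> simple_transp n"
        by (rule simple_transp_word_perm_commute)
      then have "w = simple_transp n \<circ> word_perm (as @ bs)"
        unfolding w(3) word word_perm_append by (simp only: comp_assoc[symmetric])
      then show ?thesis using v by blast
    qed
  qed
next
  fix w assume "w \<in> ?R"
  then consider "w \<in> boolean_perms n" | v where "v \<in> boolean_perms n" "w = v \<circ> simple_transp n"
    | v where "v \<in> boolean_perms n" "w = simple_transp n \<circ> v" by blast
  then show "w \<in> boolean_perms (Suc n)"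
  proof cases
    case 1
    then show ?thesis using boolean_perms_mono[of n "Suc n"] by auto
  next
    case 2
    then obtain "is" where "distinct is" "set is \<subseteq> {1..<n}" "v = word_perm is"
      unfolding in_boolean_perms_iff by blast
    with 2 assms show ?thesis
      unfolding in_boolean_perms_iff
      by (intro exI[of _ "is @ [n]"]) (auto simp: word_perm_append)
  next
    case 3
    then obtain "is" where "distinct is" "set is \<subseteq> {1..<n}" "v = word_perm is"
      unfolding in_boolean_perms_iff by blast
    with 3 assms show ?thesis
      unfolding in_boolean_perms_iff
      by (intro exI[of _ "n # is"]) auto
  qed
qed

section \<open>Recursion for sums over Boolean permutations\<close>

lemma simple_transp_Sym_commute:
  assumes "v \<in> Sym n" "v n = n" "1 \<le> n"
  shows "simple_transp n \<circ> v = v \<circ> simple_transp n"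
proof
  fix j
  have "v j \<noteq> n" if "j \<noteq> n" using that assms(2) Sym_inj[OF assms(1)] by (metis injD)
  moreover have "v j \<noteq> Suc n" if "j \<noteq> Suc n"
    using that Sym_fixes[OF assms(1), of "Suc n"] Sym_inj[OF assms(1)] by (metis injD lessI)
  ultimately show "(simple_transp n \<circ> v) j = (v \<circ> simple_transp n) j"
    using assms Sym_fixes[OF assms(1), of "Suc n"] by (auto simp: simple_transp_apply)
qed

text \<open>The values at \<open>n\<close> and \<open>n + 1\<close> tell the pieces apart: old
  elements fix \<open>n + 1\<close>, right multiples send \<open>n\<close> to \<open>n + 1\<close>,
  and the remaining left multiples send \<open>n + 1\<close> to \<open>n\<close> and keep the image
  of \<open>n\<close> at most \<open>n\<close>. If \<open>v\<close> fixes \<open>n\<close>, both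
  multiples coincide, and only the right one is counted.\<close>

lemma sum_boolean_perms_Suc:
  fixes F :: "(nat \<Rightarrow> nat) \<Rightarrow> 'a::comm_monoid_add"
  assumes n: "1 \<le> n"
  shows "sum F (boolean_perms (Suc n)) =
    (\<Sum>v\<in>boolean_perms n. F v + F (v \<circ> simple_transp n) + (if v n = n then 0 else F (simple_transp n \<circ> v)))"
proof -
  let ?B = "boolean_perms n" and ?s = "simple_transp n"
  let ?R = "(\<lambda>v. v \<circ> ?s) ` ?B" and ?L = "(\<lambda>v. ?s \<circ> v) ` {v \<in> ?B. v n \<noteq> n}"
  have Sym: "v \<in> Sym n" if "v \<in> ?B" for v using that boolean_perms_subset_Sym by blast
  have eq: "boolean_perms (Suc n) = (?B \<union> ?R) \<union> ?L"
  proof -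
    have "?s \<circ> v \<in> ?R" if "v \<in> ?B" "v n = n" for v
      using simple_transp_Sym_commute[OF Sym[OF that(1)] that(2) n] that(1) by blast
    then show ?thesis unfolding boolean_perms_Suc[OF n] by blast
  qed
  have B: "w (Suc n) = Suc n" "w n \<le> n" if "w \<in> ?B" for w
    using Sym[OF that] Sym_fixes[of w n "Suc n"] Sym_le[of w n n] by auto
  have R: "w (Suc n) \<le> n" "w n = Suc n" if "w \<in> ?R" for w
    using that B by (auto simp: simple_transp_apply)
  have L: "w (Suc n) = n" "w n \<le> n" if "w \<in> ?L" for w
  proof -
    from that obtain v where v: "v \<in> ?B" "v n \<noteq> n" "w = ?s \<circ> v" by blast
    then show "w (Suc n) = n" "w n \<le> n"
      using B[OF v(1)] by (simp_all add: simple_transp_apply)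
  qed
  have "sum F (boolean_perms (Suc n)) = sum F (?B \<union> ?R) + sum F ?L"
    unfolding eq
  proof (rule sum.union_disjoint)
    show "(?B \<union> ?R) \<inter> ?L = {}"
    proof (rule equals0I)
      fix w assume "w \<in> (?B \<union> ?R) \<inter> ?L"
      then have "w \<in> ?B \<or> w \<in> ?R" and w: "w \<in> ?L" by (simp_all only: Int_iff Un_iff)
      then show False using B(1)[of w] R(2)[of w] L[OF w] by linarith
    qed
  qed (auto simp: finite_boolean_perms)
  also have "sum F (?B \<union> ?R) = sum F ?B + sum F ?R"
  proof (rule sum.union_disjoint)
    show "?B \<inter> ?R = {}"
    proof (rule equals0I)
      fix w assume "w \<in> ?B \<inter> ?R"
      then have "w \<in> ?B" "w \<in> ?R" by (simp_all only: Int_iff)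
      then show False using B(2)[of w] R(2)[of w] by linarith
    qed
  qed (auto simp: finite_boolean_perms)
  also have "sum F ?R = (\<Sum>v\<in>?B. F (v \<circ> ?s))"
  proof -
    have "inj_on (\<lambda>v. v \<circ> ?s) ?B"
    proof (rule inj_onI)
      fix v v' assume "v \<circ> ?s = v' \<circ> ?s"
      then have "v \<circ> ?s \<circ> ?s = v' \<circ> ?s \<circ> ?s" by (simp only:)
      then show "v = v'" unfolding simple_transp_comp_involutory .
    qed
    from sum.reindex[OF this, of F] show ?thesis by (simp only: comp_def)
  qed
  also have "sum F ?L = (\<Sum>v\<in>{v \<in> ?B. v n \<noteq> n}. F (?s \<circ> v))"
  proof -
    have "inj_on (\<lambda>v. ?s \<circ> v) {v \<in> ?B. v n \<noteq> n}"
    proof (rule inj_onI)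
      fix v v' assume "?s \<circ> v = ?s \<circ> v'"
      then have "?s \<circ> ?s \<circ> v = ?s \<circ> ?s \<circ> v'" by (simp only: comp_assoc)
      then show "v = v'" unfolding simple_transp_comp_involutory id_comp .
    qed
    from sum.reindex[OF this, of F] show ?thesis by (simp only: comp_def)
  qed
  also have "\<dots> = (\<Sum>v\<in>?B. if v n = n then 0 else F (?s \<circ> v))"
    by (rule sum.mono_neutral_cong_left) (auto simp: finite_boolean_perms)
  finally show ?thesis by (simp only: sum.distrib)
qed

lemma boolean_perms_Suc_fixed:
  assumes "1 \<le> n" "w \<in> boolean_perms (Suc n)" "w (Suc n) = Suc n"
  shows "w \<in> boolean_perms n"
proof -
  have "v n \<noteq> Suc n" "v (Suc n) = Suc n" if "v \<in> boolean_perms n" for v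
    using that boolean_perms_subset_Sym[of n] Sym_le[of v n n] Sym_fixes[of v n "Suc n"] by auto
  note B = this
  have "w (Suc n) \<noteq> Suc n" if "v \<in> boolean_perms n" "w = v \<circ> simple_transp n \<or> w = simple_transp n \<circ> v" for v
    using that(2) B[OF that(1)] by (auto simp: simple_transp_apply)
  then show ?thesis
    using assms unfolding boolean_perms_Suc[OF assms(1)] by blast
qed

text \<open>Both extensions by \<open>s_n\<close> move \<open>n + 1\<close>, so an element fixing
  \<open>n + 1\<close> comes from rank \<open>n\<close>; this is repeated down to rank
  \<open>k\<close>.\<close>

lemma boolean_perms_Int_Sym:
  assumes "1 \<le> k" "k \<le> n"
  shows "boolean_perms n \<inter> Sym k \<subseteq> boolean_perms k"
  using assms(2)
proof (induction n rule: dec_induct)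
  case (step n)
  have "w \<in> boolean_perms n" if "w \<in> boolean_perms (Suc n)" "w \<in> Sym k" for w
    using boolean_perms_Suc_fixed[of n w] that step assms Sym_fixes[of w k "Suc n"] by simp
  then show ?case using step by blast
qed simp

section \<open>Change of the count when the rank grows\<close>

lemma nonrec_count_Suc_fixed:
  assumes "v \<in> Sym n"
  shows "nonrec_count i (Suc n) v = nonrec_count i n v"
proof -
  have "\<not> v (Suc n) < v k" if "k < Suc n" for k
    using Sym_le[OF assms, of k] Sym_fixes[OF assms, of "Suc n"] that by simp
  then have "{j \<in> {i<..Suc n}. \<exists>k<j. v j < v k} = {j \<in> {i<..n}. \<exists>k<j. v j < v k}"
    by (auto simp: le_Suc_eq)
  then show ?thesis by (simp add: nonrec_count_def)
qed

text \<open>The product has value \<open>n + 1\<close> at position \<open>n\<close>, which is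
  therefore a left-to-right maximum; only position \<open>n + 1\<close> can be new. If
  \<open>v\<close> moves \<open>n\<close>, position \<open>n\<close> was counted before, so the gain
  is cancelled.\<close>

lemma nonrec_count_right_le:
  assumes v: "v \<in> Sym n" and i: "i < n"
  shows "nonrec_count i (Suc n) (v \<circ> simple_transp n) \<le>
    (if v n = n then Suc (nonrec_count i n v) else nonrec_count i n v)"
proof -
  let ?w = "v \<circ> simple_transp n"
  let ?N = "{j \<in> {i<..n}. \<exists>k<j. v j < v k}"
  have "{j \<in> {i<..Suc n}. \<exists>k<j. ?w j < ?w k} \<subseteq> insert (Suc n) (?N - {n})"
  proof
    fix j assume j: "j \<in> {j \<in> {i<..Suc n}. \<exists>k<j. ?w j < ?w k}"
    show "j \<in> insert (Suc n) (?N - {n})"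
    proof (cases "j = Suc n")
      case False
      have "j \<noteq> n"
      proof
        assume "j = n"
        with j obtain k where k: "k < n" "?w n < ?w k" by blast
        then have "Suc n < v k"
          using Sym_fixes[OF v, of "Suc n"] by (simp add: simple_transp_apply)
        then show False using Sym_le[OF v, of k] k by simp
      qed
      with j False nonrec_simple_transp[of j n v] show ?thesis by auto
    qed simp
  qed
  then have "nonrec_count i (Suc n) ?w \<le> card (insert (Suc n) (?N - {n}))"
    unfolding nonrec_count_def by (rule card_mono[rotated]) simp
  also have "\<dots> = Suc (card (?N - {n}))" by simp
  also have "\<dots> \<le> (if v n = n then Suc (card ?N) else card ?N)"
  proof (cases "v n = n")
    case True
    then show ?thesis by (simp add: card_mono)
  next
    case False
    have "n \<in> v ` {1..n}" using v i unfolding Sym_def by (simp add: permutes_image)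
    then obtain k where k: "k \<in> {1..n}" "v k = n" by blast
    then have "k < n" "v n < v k"
      using False Sym_le[OF v, of n] by (auto simp: le_less)
    then have "n \<in> ?N" using i by auto
    then show ?thesis using False card_Suc_Diff1[of ?N n] by simp
  qed
  finally show ?thesis by (simp only: nonrec_count_def)
qed

text \<open>Replacing the value \<open>n\<close> by \<open>n + 1\<close> keeps the order among the
  first \<open>n\<close> positions, so only position \<open>n + 1\<close> can be new.\<close>

lemma nonrec_count_left_le:
  assumes v: "v \<in> Sym n"
  shows "nonrec_count i (Suc n) (simple_transp n \<circ> v) \<le> Suc (nonrec_count i n v)"
proof -
  let ?w = "simple_transp n \<circ> v"
  let ?N = "{j \<in> {i<..n}. \<exists>k<j. v j < v k}"
  have "{j \<in> {i<..Suc n}. \<exists>k<j. ?w j < ?w k} \<subseteq> insert (Suc n) ?N"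
  proof
    fix j assume j: "j \<in> {j \<in> {i<..Suc n}. \<exists>k<j. ?w j < ?w k}"
    then obtain k where k: "k < j" "?w j < ?w k" by blast
    show "j \<in> insert (Suc n) ?N"
    proof (cases "j = Suc n")
      case False
      then have "v j \<le> n" "v k \<le> n" using j k Sym_le[OF v] by auto
      with k have "v j < v k" by (auto simp: simple_transp_apply split: if_splits)
      then show ?thesis using j k False by auto
    qed simp
  qed
  then have "nonrec_count i (Suc n) ?w \<le> card (insert (Suc n) ?N)"
    unfolding nonrec_count_def by (rule card_mono[rotated]) simp
  also have "\<dots> \<le> Suc (card ?N)" by (simp add: card_insert_le_m1 card_insert_if)
  finally show ?thesis by (simp only: nonrec_count_def)
qed

section \<open>The expected forward stability\<close>

lemma geometric_lower:
  fixes f :: "nat \<Rightarrow> real"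
  assumes "\<And>n. m \<le> n \<Longrightarrow> b * f n \<le> f (Suc n)" "0 \<le> b" "m \<le> n"
  shows "b ^ (n - m) * f m \<le> f n"
  using assms(3)
proof (induction n rule: dec_induct)
  case (step n)
  have "b ^ (Suc n - m) * f m = b * (b ^ (n - m) * f m)" using step by (simp add: Suc_diff_le)
  also have "\<dots> \<le> b * f n" using step assms(2) by (intro mult_left_mono) auto
  also have "\<dots> \<le> f (Suc n)" using step assms(1) by simp
  finally show ?case .
qed simp

lemma geometric_upper:
  fixes f :: "nat \<Rightarrow> real"
  assumes "\<And>n. m \<le> n \<Longrightarrow> f (Suc n) \<le> b * f n" "0 \<le> b" "m \<le> n"
  shows "f n \<le> b ^ (n - m) * f m"
  using geometric_lower[of m b "\<lambda>n. - f n" n] assms by simp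

definition fixed_weight :: "real \<Rightarrow> nat \<Rightarrow> (nat \<Rightarrow> nat) \<Rightarrow> real" where
  "fixed_weight q n v = (if v n = n then q else 1)"

text \<open>With \<open>x\<close> and \<open>y\<close> the sums of \<open>t ^ nonrec_count\<close> over the Boolean permutations fixing
  resp. moving \<open>n\<close>, passing from \<open>n\<close> to \<open>n + 1\<close> maps \<open>(x, y)\<close> to at most
  \<open>(x + y, t x + (1 + t) y)\<close>.  The weight \<open>(17/25, 1)\<close> bounds the growth rate of this map at
  \<open>t = 36/25\<close> by \<open>78/25\<close>, and \<open>(61/100, 1)\<close> bounds the one at \<open>t = 1\<close> from below by \<open>261/100\<close>;
  what matters is that the ratio of these rates is less than \<open>sqrt t = 6/5\<close>.\<close>

lemma nonrec_weight_Suc: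
  assumes "i < n"
  shows "(\<Sum>v\<in>boolean_perms (Suc n). (36/25) ^ nonrec_count i (Suc n) v * fixed_weight (17/25) (Suc n) v)
    \<le> 78/25 * (\<Sum>v\<in>boolean_perms n. (36/25) ^ nonrec_count i n v * fixed_weight (17/25) n v)"
proof -
  let ?t = "36/25 :: real"
  let ?F = "\<lambda>n v. ?t ^ nonrec_count i n v * fixed_weight (17/25) n v"
  have n: "1 \<le> n" using assms by simp
  have "?F (Suc n) v + ?F (Suc n) (v \<circ> simple_transp n) +
      (if v n = n then 0 else ?F (Suc n) (simple_transp n \<circ> v)) \<le> 78/25 * ?F n v"
    if "v \<in> boolean_perms n" for v
  proof -
    have v: "v \<in> Sym n" using that boolean_perms_subset_Sym by blast
    let ?p = "?t ^ nonrec_count i n v"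
    have vn: "v (Suc n) = Suc n" "v n \<le> n" using Sym_fixes[OF v] Sym_le[OF v] by auto
    have pos: "0 < ?p" by simp
    have 1: "?F (Suc n) v = 17/25 * ?p"
      using vn by (simp add: fixed_weight_def nonrec_count_Suc_fixed[OF v])
    have mono: "?t ^ a \<le> ?t ^ b" if "a \<le> b" for a b using that by (intro power_increasing) auto
    have 2: "?F (Suc n) (v \<circ> simple_transp n) \<le> ?t ^ (if v n = n then Suc (nonrec_count i n v) else nonrec_count i n v)"
    proof -
      have "fixed_weight (17/25) (Suc n) (v \<circ> simple_transp n) = 1"
        using vn by (simp add: fixed_weight_def simple_transp_apply)
      then show ?thesis using mono[OF nonrec_count_right_le[OF v assms]] by (simp only: mult_1_right)
    qed
    have 3: "?F (Suc n) (simple_transp n \<circ> v) \<le> ?t ^ Suc (nonrec_count i n v)"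
    proof -
      have "fixed_weight (17/25) (Suc n) (simple_transp n \<circ> v) = 1"
        using vn by (simp add: fixed_weight_def simple_transp_apply)
      then show ?thesis using mono[OF nonrec_count_left_le[OF v, of i]] by (simp only: mult_1_right)
    qed
    \<comment> \<open>Comparing multiples of \<open>?p\<close>:
      \<open>17/25 + 36/25 <= 78/25 * 17/25\<close> if \<open>n\<close> is fixed, and
      \<open>17/25 + 1 + 36/25 = 78/25\<close> otherwise.\<close>
    show ?thesis
    proof (cases "v n = n")
      case True
      then have "?F n v = 17/25 * ?p" "(if v n = n then 0 else ?F (Suc n) (simple_transp n \<circ> v)) = 0"
        by (simp_all add: fixed_weight_def)
      moreover have "?F (Suc n) (v \<circ> simple_transp n) \<le> 36/25 * ?p"
        using 2 True by (simp only: simp_thms if_True power_Suc)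
      ultimately show ?thesis using 1 pos by linarith
    next
      case False
      then have "?F n v = ?p" "(if v n = n then 0 else ?F (Suc n) (simple_transp n \<circ> v)) \<le> 36/25 * ?p"
        using 3 by (simp_all only: fixed_weight_def if_False power_Suc mult_1_right)
      moreover have "?F (Suc n) (v \<circ> simple_transp n) \<le> ?p"
        using 2 False by (simp only: if_False)
      ultimately show ?thesis using 1 pos by linarith
    qed
  qed
  then show ?thesis
    unfolding sum_boolean_perms_Suc[OF n] sum_distrib_left by (intro sum_mono)
qed

text \<open>The exact growth rate is the square of the golden ratio, 2.618..., with weight 0.618...
  on the fixed state. Rounding the weight down to \<open>61/100\<close> gives
  \<open>61/100 + 1 >= 261/100 * 61/100\<close> and \<open>61/100 + 2 = 261/100\<close>.\<close>

lemma count_weight_Suc: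
  assumes "1 \<le> n"
  shows "261/100 * (\<Sum>v\<in>boolean_perms n. fixed_weight (61/100) n v)
    \<le> (\<Sum>v\<in>boolean_perms (Suc n). fixed_weight (61/100) (Suc n) v)"
proof -
  have "261/100 * fixed_weight (61/100) n v \<le> fixed_weight (61/100) (Suc n) v +
      fixed_weight (61/100) (Suc n) (v \<circ> simple_transp n) +
      (if v n = n then 0 else fixed_weight (61/100) (Suc n) (simple_transp n \<circ> v))"
    if "v \<in> boolean_perms n" for v
  proof -
    have v: "v \<in> Sym n" using that boolean_perms_subset_Sym by blast
    have "v (Suc n) = Suc n" "v n \<le> n" using Sym_fixes[OF v] Sym_le[OF v] by auto
    then show ?thesis by (simp add: fixed_weight_def simple_transp_apply)
  qed
  then show ?thesis
    unfolding sum_boolean_perms_Suc[OF assms] sum_distrib_left by (intro sum_mono)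
qed

lemma card_boolean_perms_Suc:
  assumes "1 \<le> n"
  shows "2 * real (card (boolean_perms n)) \<le> real (card (boolean_perms (Suc n)))"
proof -
  have "2 * real (card (boolean_perms n)) = (\<Sum>v\<in>boolean_perms n. 2)" by simp
  also have "\<dots> \<le> (\<Sum>v\<in>boolean_perms (Suc n). 1 :: real)"
    unfolding sum_boolean_perms_Suc[OF assms] by (intro sum_mono) simp
  finally show ?thesis by simp
qed

text \<open>Both recursions start at rank \<open>i + 1\<close>, where the count is at most 1. The
  ratio of the rates is \<open>104/87\<close>, and \<open>3600/1037\<close> is \<open>36/25\<close>
  divided by the two weights \<open>17/25\<close> and \<open>61/100\<close>.\<close>

lemma sum_nonrec_power_le:
  assumes "i < n"
  shows "(\<Sum>v\<in>boolean_perms n. (36/25) ^ nonrec_count i n v)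
    \<le> 3600/1037 * (104/87) ^ (n - Suc i) * real (card (boolean_perms n))"
proof -
  let ?t = "36/25 :: real"
  let ?W = "\<lambda>n. \<Sum>v\<in>boolean_perms n. ?t ^ nonrec_count i n v * fixed_weight (17/25) n v"
  let ?C = "\<lambda>n. \<Sum>v\<in>boolean_perms n. fixed_weight (61/100) n v"
  let ?b = "\<lambda>n. real (card (boolean_perms n))"
  let ?k = "n - Suc i"
  have "17/25 * (\<Sum>v\<in>boolean_perms n. ?t ^ nonrec_count i n v) \<le> ?W n"
    unfolding sum_distrib_left by (intro sum_mono) (simp add: fixed_weight_def)
  also have "?W n \<le> (78/25) ^ ?k * ?W (Suc i)"
    using assms by (intro geometric_upper nonrec_weight_Suc) auto
  also have "?W (Suc i) \<le> (\<Sum>v\<in>boolean_perms (Suc i). ?t)"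
  proof (rule sum_mono)
    fix v
    have "?t ^ nonrec_count i (Suc i) v \<le> ?t ^ 1"
      using nonrec_count_le[of i "Suc i" v] by (intro power_increasing) auto
    then show "?t ^ nonrec_count i (Suc i) v * fixed_weight (17/25) (Suc i) v \<le> ?t"
      by (simp add: fixed_weight_def)
  qed
  also have "\<dots> = ?t * ?b (Suc i)" by simp
  finally have upper: "17/25 * (\<Sum>v\<in>boolean_perms n. ?t ^ nonrec_count i n v)
      \<le> (78/25) ^ ?k * (?t * ?b (Suc i))"
    by (simp add: mult_left_mono)
  have "61/100 * ?b (Suc i) = (\<Sum>v\<in>boolean_perms (Suc i). 61/100)" by simp
  also have "\<dots> \<le> ?C (Suc i)" by (intro sum_mono) (simp add: fixed_weight_def)
  finally have "(261/100) ^ ?k * (61/100 * ?b (Suc i)) \<le> (261/100) ^ ?k * ?C (Suc i)"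
    by (intro mult_left_mono) auto
  also have "\<dots> \<le> ?C n"
    using assms by (intro geometric_lower count_weight_Suc) auto
  also have "\<dots> \<le> (\<Sum>v\<in>boolean_perms n. 1)" by (intro sum_mono) (simp add: fixed_weight_def)
  finally have lower: "(261/100) ^ ?k * (61/100 * ?b (Suc i)) \<le> ?b n" by simp
  have split: "(78/25 :: real) ^ ?k = (104/87) ^ ?k * (261/100) ^ ?k"
    by (simp flip: power_mult_distrib)
  have "(\<Sum>v\<in>boolean_perms n. ?t ^ nonrec_count i n v)
      \<le> 3600/1037 * (104/87) ^ ?k * ((261/100) ^ ?k * (61/100 * ?b (Suc i)))"
    using upper unfolding split by (simp add: field_simps)
  also have "\<dots> \<le> 3600/1037 * (104/87) ^ ?k * ?b n"
    by (intro mult_left_mono lower) auto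
  finally show ?thesis .
qed

text \<open>Bernoulli's inequality for \<open>36/25 = 1 + 11/25\<close>. Replacing the truncated
  difference by a power lets the double sum over \<open>u\<close> and \<open>v\<close>
  factor.\<close>

lemma truncated_diff_le_power:
  "real (a - b) \<le> 25/11 * ((36/25) ^ a / (36/25) ^ b)"
proof (cases "a \<le> b")
  case False
  have "1 + real (a - b) * (11/25) \<le> (1 + 11/25) ^ (a - b)"
    by (rule Bernoulli_inequality) simp
  also have "\<dots> = (36/25) ^ a / (36/25) ^ b"
    using False by (simp add: power_diff)
  finally show ?thesis by simp
qed simp

lemma sum_excess_le:
  assumes "i < n"
  shows "(\<Sum>u\<in>boolean_perms n. \<Sum>v\<in>boolean_perms n.
      real (nonrec_count i n u + nonrec_count i n v - (n - i)))
    \<le> 20 * (67600/68121) ^ (n - Suc i) * (real (card (boolean_perms n)))\<^sup>2"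
proof -
  let ?B = "boolean_perms n" and ?t = "36/25 :: real" and ?k = "n - Suc i"
  let ?S = "\<Sum>v\<in>?B. ?t ^ nonrec_count i n v"
  have k: "n - i = Suc ?k" using assms by simp
  have "(\<Sum>u\<in>?B. \<Sum>v\<in>?B. real (nonrec_count i n u + nonrec_count i n v - (n - i)))
      \<le> (\<Sum>u\<in>?B. \<Sum>v\<in>?B. 25/11 * (?t ^ (nonrec_count i n u + nonrec_count i n v) / ?t ^ (n - i)))"
    by (intro sum_mono truncated_diff_le_power)
  also have "\<dots> = 25/11 * (?S\<^sup>2 / ?t ^ (n - i))"
  proof -
    have "?S\<^sup>2 = (\<Sum>u\<in>?B. \<Sum>v\<in>?B. ?t ^ (nonrec_count i n u + nonrec_count i n v))"
      by (simp only: power2_eq_square sum_product power_add)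
    then show ?thesis by (simp only: sum_distrib_left sum_divide_distrib)
  qed
  also have "\<dots> \<le> 25/11 * ((3600/1037 * (104/87) ^ ?k * real (card ?B))\<^sup>2 / ?t ^ (n - i))"
    using sum_nonrec_power_le[OF assms]
    by (intro mult_left_mono divide_right_mono power_mono) (auto intro!: sum_nonneg)
  also have "\<dots> = 25/11 * (3600/1037)\<^sup>2 / ?t * (((104/87)\<^sup>2 / ?t) ^ ?k) * (real (card ?B))\<^sup>2"
  proof -
    have "25/11 * ((c * r ^ m * b)\<^sup>2 / t ^ Suc m) = 25/11 * c\<^sup>2 / t * (r\<^sup>2 / t) ^ m * b\<^sup>2"
      for c r b t :: real and m
    proof -
      have "(r ^ m)\<^sup>2 = (r\<^sup>2) ^ m" by (simp only: power_mult[symmetric] mult.commute)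
      then show ?thesis by (simp add: power_mult_distrib power_divide)
    qed
    then show ?thesis unfolding k .
  qed
  \<comment> \<open>This is below 1 because \<open>104/87 < 6/5\<close>, so the excesses decay
    geometrically in \<open>n - i\<close>.\<close>
  also have "(104/87)\<^sup>2 / ?t = 67600/68121" by (simp add: power2_eq_square)
  also have "25/11 * (3600/1037)\<^sup>2 / ?t * (67600/68121) ^ ?k * (real (card ?B))\<^sup>2
      \<le> 20 * (67600/68121) ^ ?k * (real (card ?B))\<^sup>2"
    by (intro mult_right_mono) (auto simp: power2_eq_square)
  finally show ?thesis .
qed

section \<open>Bounds for the total forward stability\<close>

lemma sum_power_reverse_le:
  fixes r :: real
  assumes "0 \<le> r" "r < 1"
  shows "(\<Sum>i=1..<n. r ^ (n - Suc i)) \<le> 1 / (1 - r)"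
proof -
  have "(\<Sum>i=1..<n. r ^ (n - Suc i)) \<le> (\<Sum>i<n. r ^ (n - Suc i))"
    by (rule sum_mono2) (use assms in auto)
  also have "\<dots> = (\<Sum>i<n. r ^ i)"
    by (rule sum.nat_diff_reindex)
  also have "\<dots> \<le> suminf (\<lambda>i. r ^ i)"
    by (rule sum_le_suminf) (use assms in \<open>auto intro: summable_geometric\<close>)
  also have "\<dots> = 1 / (1 - r)"
    by (rule suminf_geometric) (use assms in simp)
  finally show ?thesis .
qed

lemma sum_FS_upper:
  assumes "1 \<le> n"
  shows "(\<Sum>u\<in>boolean_perms n. \<Sum>v\<in>boolean_perms n. real (FS u v))
    \<le> (real n + 3000) * (real (card (boolean_perms n)))\<^sup>2"
proof -
  let ?B = "boolean_perms n" and ?r = "67600/68121 :: real"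
  let ?e = "\<lambda>i u v. real (nonrec_count i n u + nonrec_count i n v - (n - i))"
  have Sym: "v \<in> Sym n" if "v \<in> ?B" for v using that boolean_perms_subset_Sym by blast
  have "(\<Sum>u\<in>?B. \<Sum>v\<in>?B. real (FS u v)) \<le> (\<Sum>u\<in>?B. \<Sum>v\<in>?B. real n + (\<Sum>i=1..<n. ?e i u v))"
  proof (intro sum_mono)
    fix u v assume "u \<in> ?B" "v \<in> ?B"
    then have "real (FS u v) \<le> real (n + (\<Sum>i=1..<n. nonrec_count i n u + nonrec_count i n v - (n - i)))"
      using FS_upper_bound[OF Sym Sym assms] by (intro of_nat_mono)
    then show "real (FS u v) \<le> real n + (\<Sum>i=1..<n. ?e i u v)" by simp
  qed
  also have "\<dots> = real n * (real (card ?B))\<^sup>2 + (\<Sum>u\<in>?B. \<Sum>v\<in>?B. \<Sum>i=1..<n. ?e i u v)"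
    by (simp add: sum.distrib power2_eq_square)
  also have "(\<Sum>u\<in>?B. \<Sum>v\<in>?B. \<Sum>i=1..<n. ?e i u v) = (\<Sum>u\<in>?B. \<Sum>i=1..<n. \<Sum>v\<in>?B. ?e i u v)"
    by (rule sum.cong[OF refl sum.swap])
  also have "\<dots> = (\<Sum>i=1..<n. \<Sum>u\<in>?B. \<Sum>v\<in>?B. ?e i u v)"
    by (rule sum.swap)
  also have "\<dots> \<le> (\<Sum>i=1..<n. 20 * ?r ^ (n - Suc i) * (real (card ?B))\<^sup>2)"
    by (intro sum_mono sum_excess_le) auto
  also have "\<dots> = 20 * (\<Sum>i=1..<n. ?r ^ (n - Suc i)) * (real (card ?B))\<^sup>2"
    by (simp only: sum_distrib_left sum_distrib_right)
  also have "\<dots> \<le> 20 * (1 / (1 - ?r)) * (real (card ?B))\<^sup>2"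
    by (intro mult_left_mono mult_right_mono sum_power_reverse_le) auto
  \<comment> \<open>\<open>20 / (1 - ?r) = 20 * 68121 / 521\<close>, about 2615.\<close>
  also have "\<dots> \<le> 3000 * (real (card ?B))\<^sup>2"
    by (intro mult_right_mono) auto
  finally show ?thesis by (simp add: distrib_right)
qed

text \<open>Since \<open>u\<close> lies in \<open>Sym k\<close> for every
  \<open>k >= FS u v\<close>, the deficit \<open>n - FS u v\<close> is at most the number of
  \<open>k < n\<close> with \<open>u\<close> in \<open>Sym k\<close>. The share of such
  \<open>u\<close> is geometrically small in \<open>n - k\<close>.\<close>

lemma sum_FS_lower:
  assumes "1 \<le> n" "v \<in> boolean_perms n"
  shows "(real n - 2) * real (card (boolean_perms n)) \<le> (\<Sum>u\<in>boolean_perms n. real (FS u v))"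
proof -
  let ?B = "boolean_perms n"
  let ?b = "\<lambda>n. real (card (boolean_perms n))"
  have inf: "u \<in> Sym_inf" if "u \<in> ?B" for u
    using that boolean_perms_subset_Sym Sym_inf_iff by blast
  have "real n - real (FS u v) \<le> (\<Sum>k=1..<n. if u \<in> Sym k then 1 else 0)" if u: "u \<in> ?B" for u
  proof -
    note FS = FS_props[OF inf[OF u] inf[OF assms(2)]]
    have "{FS u v..<n} \<subseteq> {k \<in> {1..<n}. u \<in> Sym k}"
      using FS Sym_mono[OF _ FS(2)] by auto
    then have "card {FS u v..<n} \<le> card {k \<in> {1..<n}. u \<in> Sym k}"
      by (rule card_mono[rotated]) simp
    then have "real n - real (FS u v) \<le> real (card {k \<in> {1..<n}. u \<in> Sym k})" by simp
    also have "\<dots> = (\<Sum>k=1..<n. if u \<in> Sym k then 1 else 0)"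
      by (simp add: sum.inter_filter[symmetric])
    finally show ?thesis .
  qed
  then have "(\<Sum>u\<in>?B. real n - real (FS u v)) \<le> (\<Sum>u\<in>?B. \<Sum>k=1..<n. if u \<in> Sym k then 1 else 0)"
    by (rule sum_mono)
  also have "\<dots> = (\<Sum>k=1..<n. \<Sum>u\<in>?B. if u \<in> Sym k then 1 else 0)" by (rule sum.swap)
  \<comment> \<open>The exponent is one less than the doubling of the cardinality gives; this fits
    \<open>sum_power_reverse_le\<close> and makes the total 2.\<close>
  also have "\<dots> \<le> (\<Sum>k=1..<n. (1/2) ^ (n - Suc k) * ?b n)"
  proof (rule sum_mono)
    fix k assume k: "k \<in> {1..<n}"
    have "(\<Sum>u\<in>?B. if u \<in> Sym k then 1 else 0) = real (card (?B \<inter> Sym k))"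
      by (simp add: sum.If_cases finite_boolean_perms Int_def)
    also have "\<dots> \<le> ?b k"
      using boolean_perms_Int_Sym[of k n] k by (intro of_nat_mono card_mono finite_boolean_perms) auto
    also have "\<dots> \<le> (1/2) ^ (n - Suc k) * ?b n"
    proof -
      have "2 ^ (n - k) * ?b k \<le> ?b n"
        using k card_boolean_perms_Suc by (intro geometric_lower) auto
      moreover have "2 ^ (n - Suc k) * ?b k \<le> 2 ^ (n - k) * ?b k"
        by (intro mult_right_mono power_increasing) auto
      ultimately have "2 ^ (n - Suc k) * ?b k \<le> ?b n" by simp
      then show ?thesis by (simp add: power_one_over field_simps)
    qed
    finally show "(\<Sum>u\<in>?B. if u \<in> Sym k then 1 else 0) \<le> (1/2) ^ (n - Suc k) * ?b n" .
  qed
  also have "\<dots> = (\<Sum>k=1..<n. (1/2) ^ (n - Suc k)) * ?b n" by (simp only: sum_distrib_right)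
  also have "\<dots> \<le> 1 / (1 - 1/2) * ?b n"
    by (intro mult_right_mono sum_power_reverse_le) auto
  finally show ?thesis by (simp add: sum_subtractf algebra_simps)
qed

lemma pair_pmf_of_set:
  assumes "finite A" "A \<noteq> {}" "finite B" "B \<noteq> {}"
  shows "pair_pmf (pmf_of_set A) (pmf_of_set B) = pmf_of_set (A \<times> B)"
proof (rule pmf_eqI)
  fix p
  show "pmf (pair_pmf (pmf_of_set A) (pmf_of_set B)) p = pmf (pmf_of_set (A \<times> B)) p"
    using assms by (cases p) (simp add: pmf_pair pmf_of_set indicator_def card_cartesian_product)
qed

theorem theorem1p4:
  shows "(\<lambda>n. measure_pmf.expectation
              (pair_pmf (pmf_of_set (boolean_perms n)) (pmf_of_set (boolean_perms n)))
              (\<lambda>(u, v). real (FS u v))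
            - real n) \<in> O(\<lambda>_. 1)"
proof (rule bigoI[where c = 3000])
  show "\<forall>\<^sub>F n in at_top. norm (measure_pmf.expectation
              (pair_pmf (pmf_of_set (boolean_perms n)) (pmf_of_set (boolean_perms n)))
              (\<lambda>(u, v). real (FS u v)) - real n) \<le> 3000 * norm (1 :: real)"
    using eventually_ge_at_top[of 1]
  proof eventually_elim
    case (elim n)
    let ?B = "boolean_perms n"
    let ?b = "real (card ?B)"
    let ?S = "\<Sum>u\<in>?B. \<Sum>v\<in>?B. real (FS u v)"
    have ne: "?B \<noteq> {}" using id_in_boolean_perms by blast
    then have b: "0 < ?b" by (simp add: card_gt_0_iff finite_boolean_perms)
    have "measure_pmf.expectation (pair_pmf (pmf_of_set ?B) (pmf_of_set ?B)) (\<lambda>(u, v). real (FS u v))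
        = (\<Sum>(u, v)\<in>?B \<times> ?B. real (FS u v)) / real (card (?B \<times> ?B))"
      unfolding pair_pmf_of_set[OF finite_boolean_perms ne finite_boolean_perms ne]
      by (rule integral_pmf_of_set) (use ne in \<open>auto simp: finite_boolean_perms\<close>)
    also have "\<dots> = ?S / ?b\<^sup>2"
      by (simp add: sum.cartesian_product card_cartesian_product power2_eq_square)
    finally have E: "measure_pmf.expectation (pair_pmf (pmf_of_set ?B) (pmf_of_set ?B))
        (\<lambda>(u, v). real (FS u v)) = ?S / ?b\<^sup>2" .
    have "?S / ?b\<^sup>2 \<le> real n + 3000"
      using sum_FS_upper[OF elim] b by (simp add: pos_divide_le_eq)
    \<comment> \<open>The lower estimate holds for each fixed \<open>v\<close>, so it survives
      averaging over \<open>v\<close>; the deviation below \<open>n\<close> is at most 2.\<close>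
    moreover have "real n - 2 \<le> ?S / ?b\<^sup>2"
    proof -
      have "(real n - 2) * ?b\<^sup>2 = (\<Sum>v\<in>?B. (real n - 2) * ?b)"
        by (simp add: power2_eq_square)
      also have "\<dots> \<le> (\<Sum>v\<in>?B. \<Sum>u\<in>?B. real (FS u v))"
        by (intro sum_mono sum_FS_lower elim)
      also have "\<dots> = ?S" by (rule sum.swap)
      finally show ?thesis using b by (simp add: pos_le_divide_eq)
    qed
    ultimately show ?case unfolding E by simp
  qed
qed

end
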